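(* Let $n>2$, $m<m_*$ and $D>0$. Assume that either $0<v_0(x)<V_D(x)$ for all $x\in\mathbb{R}^n$, or $v_0(x)>V_D(x)$ for all $x\in\mathbb{R}^n$. Then for any $\varepsilon>0$ there exists $C_\varepsilon>0$ such that the solution $v$ of the rescaled fast diffusion equation with $v(x,0)=v_0(x)$, $x\in\mathbb{R}^n$, satisfies $$\sup_{x\in\mathbb{R}^n}|V_D(x)-v(x,t)|\ge C_\varepsilon e^{-(\alpha_\star+\varepsilon)t},\qquad t\ge 0.$$
   Context: Here $n$ is the (integer) space dimension, $m_*:=\frac{n-4}{n-2}$, $\mu:=\frac{2}{1-m}$ (so $\mu+2<n$ when $n>2$, $m<m_*$), and $\alpha_\star:=\frac{(n-\mu-2)^2}{4}$. For $D>0$, $V_D(x):=(D+|x|^2)^{-1/(1-m)}=(D+|x|^2)^{-\mu/2}$, $x\in\mathbb{R}^n$. The rescaled fast diffusion equation is $$v_t=\nabla\cdot(v^{m-1}\nabla v)+\mu\,\nabla\cdot(x\,v),\qquad t>0,\ x\in\mathbb{R}^n.$$ The initial function $v_0$ is continuous on $\mathbb{R}^n$, and "the solution" means the positive solution of the Cauchy problem with initial data $v_0$.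
   Formalization: For m ≤ 0 positive solutions with the same initial data need not be unique, so "the solution" is taken to be the maximal one (above every positive solution starting at or below v_0); solutions existing only on a finite time interval are also covered. *)

theory Defs
  imports "HOL-Analysis.Analysis"
begin

text \<open>
  The space \<open>\<real>\<^sup>n\<close> is an arbitrary type \<open>'a\<close> of class \<open>euclidean_space\<close>, with \<open>n = DIM('a)\<close>.
  Functions of space and time are curried, \<open>v x t\<close>.
\<close>

definition grad :: "('a::euclidean_space \<Rightarrow> real) \<Rightarrow> 'a \<Rightarrow> 'a" where
  "grad f x = (\<Sum>b\<in>Basis. frechet_derivative f (at x) b *\<^sub>R b)"

definition divergence :: "('a::euclidean_space \<Rightarrow> 'a) \<Rightarrow> 'a \<Rightarrow> real" where
  "divergence F x = (\<Sum>b\<in>Basis. frechet_derivative F (at x) b \<bullet> b)"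

definition m_star :: "nat \<Rightarrow> real" where
  "m_star n = (real n - 4) / (real n - 2)"

definition fde_mu :: "real \<Rightarrow> real" where
  "fde_mu m = 2 / (1 - m)"

definition alpha_star :: "nat \<Rightarrow> real \<Rightarrow> real" where
  "alpha_star n m = (real n - fde_mu m - 2)\<^sup>2 / 4"

definition barenblatt :: "real \<Rightarrow> real \<Rightarrow> 'a::euclidean_space \<Rightarrow> real" where
  "barenblatt m D x = (D + (norm x)\<^sup>2) powr (- 1 / (1 - m))"

text \<open>
  Positive classical solutions on \<open>\<real>\<^sup>n \<times> [0,T)\<close>, where \<open>T\<close> may be \<open>\<infinity>\<close>: continuous up to \<open>t = 0\<close>,
  and of class \<open>C\<^sup>1\<close> in \<open>t\<close> and \<open>C\<^sup>2\<close> in \<open>x\<close> for \<open>0 < t < T\<close>.  A finite \<open>T\<close> has to be admitted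
  because data below the Barenblatt profile can lead to extinction in finite time, even for the
  rescaled equation.
\<close>

definition positive_classical_solution ::
    "real \<Rightarrow> ereal \<Rightarrow> ('a::euclidean_space \<Rightarrow> real \<Rightarrow> real) \<Rightarrow> bool" where
  "positive_classical_solution m T v \<longleftrightarrow>
     (let Q = UNIV \<times> {t. 0 < t \<and> ereal t < T} in
      (\<forall>x t. 0 \<le> t \<and> ereal t < T \<longrightarrow> 0 < v x t) \<and>
      continuous_on (UNIV \<times> {t. 0 \<le> t \<and> ereal t < T}) (\<lambda>(x, t). v x t) \<and>
      (\<forall>(x, t)\<in>Q. (\<lambda>s. v x s) differentiable (at t)) \<and>
      (\<forall>(x, t)\<in>Q. (\<lambda>y. v y t) differentiable (at x)) \<and>
      (\<forall>(x, t)\<in>Q. grad (\<lambda>y. v y t) differentiable (at x)) \<and>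
      continuous_on Q (\<lambda>(x, t). deriv (\<lambda>s. v x s) t) \<and>
      continuous_on Q (\<lambda>(x, t). grad (\<lambda>y. v y t) x) \<and>
      (\<forall>b\<in>Basis. continuous_on Q (\<lambda>(x, t). frechet_derivative (grad (\<lambda>y. v y t)) (at x) b)) \<and>
      (\<forall>(x, t)\<in>Q.
         deriv (\<lambda>s. v x s) t =
           divergence (\<lambda>y. (v y t) powr (m - 1) *\<^sub>R grad (\<lambda>z. v z t) y) x
           + fde_mu m * divergence (\<lambda>y. v y t *\<^sub>R y) x))"

text \<open>
  The solution of the Cauchy problem with initial function \<open>v0\<close>, on the time interval \<open>[0,T)\<close>.
  For \<open>0 < m < 1\<close> a positive classical solution is determined by its initial function.  For
  \<open>m \<le> 0\<close> it need not be, as mass can be lost at infinity: for \<open>-1 < m \<le> 0\<close> the one-dimensional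
  solutions with prescribed flux at infinity, regarded as functions of one coordinate of \<open>x\<close>, are
  different positive classical solutions with the same data.  As usual in this range, the solution
  then means the maximal one, the decreasing limit of the solutions on balls that are infinite on
  the lateral boundary; it lies above every positive classical solution whose initial function
  does not exceed \<open>v0\<close>.
\<close>

definition cauchy_solution ::
    "real \<Rightarrow> ereal \<Rightarrow> ('a::euclidean_space \<Rightarrow> real) \<Rightarrow> ('a \<Rightarrow> real \<Rightarrow> real) \<Rightarrow> bool" where
  "cauchy_solution m T v0 v \<longleftrightarrow>
     positive_classical_solution m T v \<and>
     (\<forall>x. v x 0 = v0 x) \<and>
     (m \<le> 0 \<longrightarrow>
        (\<forall>w. positive_classical_solution m T w \<and> (\<forall>x. w x 0 \<le> v0 x) \<longrightarrow>
             (\<forall>x t. 0 \<le> t \<and> ereal t < T \<longrightarrow> w x t \<le> v x t)))"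

end

theory Submission
  imports Defs
begin

text \<open>
  Put \<open>k = 1 / (1 - m) = \<mu> / 2\<close>.  In the variable \<open>z = v\<^bsup>m-1\<^esup>\<close> the Barenblatt profile becomes the
  quadratic \<open>Z = D + |x|\<^sup>2\<close>, and the equation becomes
  \<open>z\<^sub>t = z \<Delta>z - k |\<nabla>z|\<^sup>2 + 2k x\<cdot>\<nabla>z - 2n z\<close>.  Let \<open>\<sigma> = 1\<close> if \<open>v0\<close> lies below the profile and \<open>\<sigma> = -1\<close>
  if it lies above, so that \<open>g = \<sigma> (z - Z)\<close> is positive at \<open>t = 0\<close>.  The terms of order zero cancel:
  \<open>g\<^sub>t = (Z + \<sigma>g) \<Delta>g - 2k x\<cdot>\<nabla>g - \<sigma>k |\<nabla>g|\<^sup>2\<close>.  The proof is a comparison of \<open>g\<close> with three barriers of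
  the form \<open>c(t) \<Phi>(Z)\<close> with exponential \<open>c\<close>.  The touching argument is the same for all of
  them and is made once, in \<open>radial_barrier\<close>.

  The function \<open>g\<close> stays nonnegative, that is, the solution does not cross the profile.  Below the
  profile, \<open>z > 0\<close> gives \<open>g > -Z\<close>, so \<open>-\<delta> e\<^bsup>Kt\<^esup> Z\<^sup>2\<close> is a barrier on large balls
  (\<open>pressure_deviation_nonneg_below\<close>).  Above the profile no bound on the growth of \<open>-g\<close> is available.
  For \<open>m \<le> 0\<close> the claim is the maximality of \<open>v\<close>, tested with the stationary solution \<open>V\<^sub>D\<close>
  (\<open>barenblatt_stationary\<close>).  For \<open>0 < m < 1\<close>, that is, for \<open>k > 1\<close>, the gradient term dominates
  \<open>\<Phi> \<Delta>\<Phi> - k |\<nabla>\<Phi>|\<^sup>2\<close> for profiles that become infinite on the boundary of a ball, and such barriers need no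
  information on \<open>g\<close> there (\<open>pressure_deviation_nonneg_above\<close>).

  The rate comes from the linear part \<open>Z \<Delta> - 2k x\<cdot>\<nabla>\<close>.  Far away it acts on functions of \<open>\<tau> = ln Z\<close> as
  \<open>4 d\<^sup>2/d\<tau>\<^sup>2 + 4b d/d\<tau>\<close> with \<open>b = (n - \<mu> - 2) / 2\<close>, and on \<open>e\<^bsup>-b\<tau>/2\<^esup> f(\<tau>)\<close> as \<open>4f'' - b\<^sup>2 f\<close>.  Here
  \<open>b\<^sup>2 = \<alpha>\<^sub>\<star>\<close> is the bottom of the spectrum, and beyond it there are oscillating solutions.  With decay rate
  \<open>b\<^sup>2 + \<epsilon>\<close> and \<open>4\<omega>\<^sup>2 = \<epsilon>\<close> the function \<open>f = 1/2 + cos (\<omega>\<tau>)\<close> is a strict subsolution, uniformly in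
  \<open>\<tau>\<close>, and it is negative at both ends of a period.  One period, placed on an annulus far
  from the origin, is therefore a barrier below \<open>g \<ge> 0\<close>; the strictness absorbs the lower order terms and, for
  small amplitude, the quadratic ones (\<open>pressure_deviation_decay_bound\<close>).  Its amplitude depends on \<open>v\<close> only through \<open>v0\<close>.  At
  the crest this bounds \<open>|z - Z|\<close>, hence \<open>|v - V\<^sub>D|\<close>, from below.
\<close>

section \<open>Second derivatives along lines\<close>

text \<open>
  Second order data along a single line: the equation and the touching argument involve the Hessian
  only through its diagonal.  The first derivative is required near \<open>x\<close> only, as barriers live on
  subdomains.
\<close>

definition jet2 :: "('a::real_normed_vector \<Rightarrow> real) \<Rightarrow> 'a \<Rightarrow> 'a \<Rightarrow> real \<Rightarrow> real \<Rightarrow> bool" where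
  "jet2 f x b p q \<longleftrightarrow>
     (\<exists>f'. (\<forall>\<^sub>F s in nhds 0. ((\<lambda>r. f (x + r *\<^sub>R b)) has_real_derivative f' s) (at s)) \<and>
           f' 0 = p \<and> (f' has_real_derivative q) (at 0))"

lemma jet2_diff:
  assumes "jet2 f x b p q" "jet2 h x b p' q'"
  shows "jet2 (\<lambda>y. f y - h y) x b (p - p') (q - q')"
proof -
  obtain f' where f: "\<forall>\<^sub>F s in nhds 0. ((\<lambda>r. f (x + r *\<^sub>R b)) has_real_derivative f' s) (at s)"
    "f' 0 = p" "(f' has_real_derivative q) (at 0)" using assms(1) unfolding jet2_def by auto
  obtain h' where h: "\<forall>\<^sub>F s in nhds 0. ((\<lambda>r. h (x + r *\<^sub>R b)) has_real_derivative h' s) (at s)"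
    "h' 0 = p'" "(h' has_real_derivative q') (at 0)" using assms(2) unfolding jet2_def by auto
  show ?thesis unfolding jet2_def
  proof (intro exI[of _ "\<lambda>s. f' s - h' s"] conjI)
    show "\<forall>\<^sub>F s in nhds 0. ((\<lambda>r. f (x + r *\<^sub>R b) - h (x + r *\<^sub>R b)) has_real_derivative f' s - h' s) (at s)"
      using f(1) h(1) by eventually_elim (rule DERIV_diff)
  qed (use f h in \<open>auto intro: DERIV_diff\<close>)
qed

lemma jet2_local_min:
  assumes jet: "jet2 f x b p q" and min: "\<forall>\<^sub>F s in nhds 0. f x \<le> f (x + s *\<^sub>R b)"
  shows "p = 0" "q \<ge> 0"
proof -
  obtain f' where f: "\<forall>\<^sub>F s in nhds 0. ((\<lambda>r. f (x + r *\<^sub>R b)) has_real_derivative f' s) (at s)"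
    "f' 0 = p" "(f' has_real_derivative q) (at 0)" using jet unfolding jet2_def by auto
  obtain d where d: "d > 0"
    "\<And>s. \<bar>s\<bar> < d \<Longrightarrow> ((\<lambda>r. f (x + r *\<^sub>R b)) has_real_derivative f' s) (at s)"
    "\<And>s. \<bar>s\<bar> < d \<Longrightarrow> f x \<le> f (x + s *\<^sub>R b)"
    using eventually_conj[OF f(1) min] unfolding eventually_nhds_metric dist_real_def by auto
  have "f' 0 = 0"
    by (rule DERIV_local_min[where d=d and f="\<lambda>r. f (x + r *\<^sub>R b)" and x=0])
       (use d in \<open>auto simp: abs_minus_commute\<close>)
  then show p: "p = 0" using f(2) by simp
  show "q \<ge> 0"
  proof (rule ccontr)
    assume "\<not> q \<ge> 0"
    then obtain e where e: "e > 0" "\<And>h. h > 0 \<Longrightarrow> h < e \<Longrightarrow> f' (0 + h) < f' 0"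
      using DERIV_neg_dec_right[OF f(3)] by auto
    define s where "s = min d e / 2"
    have s: "0 < s" "s < d" "s < e" using d(1) e(1) by (auto simp: s_def)
    have "\<exists>r. 0 < r \<and> r < s \<and> f (x + s *\<^sub>R b) - f (x + 0 *\<^sub>R b) = (s - 0) * f' r"
      by (rule MVT2[where f="\<lambda>r. f (x + r *\<^sub>R b)"]) (use s d in auto)
    then obtain r where r: "0 < r" "r < s" "f (x + s *\<^sub>R b) - f x = s * f' r" by auto
    have "f' r < 0" using e(2)[of r] r s \<open>f' 0 = 0\<close> by simp
    then have "s * f' r < 0" using s(1) by (simp add: mult_pos_neg)
    then show False using d(3)[of s] r(3) s by auto
  qed
qed

text \<open>
  The stationary quadratic \<open>Z\<close>, which is the power \<open>m - 1\<close> of the Barenblatt profile.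
\<close>

definition bpress :: "real \<Rightarrow> 'a::real_normed_vector \<Rightarrow> real" where
  "bpress D x = D + (norm x)\<^sup>2"

lemma bpress_line_deriv:
  fixes x b :: "'a::real_inner"
  shows "((\<lambda>r. bpress D (x + r *\<^sub>R b)) has_real_derivative 2 * ((x + s *\<^sub>R b) \<bullet> b)) (at s)"
  unfolding bpress_def power2_norm_eq_inner inner_add_left inner_add_right inner_scaleR_left inner_scaleR_right
  by (auto intro!: derivative_eq_intros simp: algebra_simps inner_commute)

lemma bpress_line_tendsto:
  fixes x b :: "'a::real_inner"
  shows "((\<lambda>s. bpress D (x + s *\<^sub>R b)) \<longlongrightarrow> bpress D x) (nhds 0)"
  using tendsto_at_iff_tendsto_nhds[of "\<lambda>s. bpress D (x + s *\<^sub>R b)" 0]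
    DERIV_isCont[OF bpress_line_deriv[of D x b 0]] by (simp add: isCont_def)

lemma continuous_bpress [continuous_intros]:
  "continuous_on S f \<Longrightarrow> continuous_on S (\<lambda>y. bpress D (f y))"
  unfolding bpress_def by (intro continuous_intros)

lemma jet2_radial:
  fixes x b :: "'a::euclidean_space"
  assumes J: "open J" "bpress D x \<in> J" and b: "b \<in> Basis"
    and F1: "\<And>r. r \<in> J \<Longrightarrow> (F has_real_derivative F1 r) (at r)"
    and F2: "\<And>r. r \<in> J \<Longrightarrow> (F1 has_real_derivative F2 r) (at r)"
  shows "jet2 (\<lambda>y. c * F (bpress D y)) x b (2 * c * F1 (bpress D x) * (x \<bullet> b))
           (c * (4 * F2 (bpress D x) * (x \<bullet> b)\<^sup>2 + 2 * F1 (bpress D x)))"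
proof -
  let ?Z = "\<lambda>s. bpress D (x + s *\<^sub>R b)"
  have Zd: "(?Z has_real_derivative 2 * ((x + s *\<^sub>R b) \<bullet> b)) (at s)" for s
    by (rule bpress_line_deriv)
  have ev: "\<forall>\<^sub>F s in nhds 0. ?Z s \<in> J" using bpress_line_tendsto J topological_tendstoD by blast
  have bb: "b \<bullet> b = 1" using b by simp
  show ?thesis unfolding jet2_def
  proof (intro exI[of _ "\<lambda>s. c * (F1 (?Z s) * (2 * ((x + s *\<^sub>R b) \<bullet> b)))"] conjI)
    show "\<forall>\<^sub>F s in nhds 0. ((\<lambda>r. c * F (?Z r)) has_real_derivative
        c * (F1 (?Z s) * (2 * ((x + s *\<^sub>R b) \<bullet> b)))) (at s)"
      using ev
    proof eventually_elim
      case (elim s)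
      show ?case by (rule DERIV_cmult, rule DERIV_chain2[OF F1[OF elim] Zd])
    qed
    show "((\<lambda>s. c * (F1 (?Z s) * (2 * ((x + s *\<^sub>R b) \<bullet> b)))) has_real_derivative
       c * (4 * F2 (bpress D x) * (x \<bullet> b)\<^sup>2 + 2 * F1 (bpress D x))) (at 0)"
    proof -
      have "((\<lambda>s. F1 (?Z s)) has_real_derivative F2 (?Z 0) * (2 * ((x + 0 *\<^sub>R b) \<bullet> b))) (at 0)"
        by (rule DERIV_chain2[OF _ Zd]) (use F2 J in simp)
      moreover have "((\<lambda>s. 2 * ((x + s *\<^sub>R b) \<bullet> b)) has_real_derivative 2) (at 0)"
        unfolding inner_add_left inner_scaleR_left bb by (auto intro!: derivative_eq_intros)
      ultimately show ?thesis
        by (rule DERIV_cong[OF DERIV_cmult[OF DERIV_mult]]) (simp add: power2_eq_square algebra_simps)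
    qed
  qed (simp)
qed

section \<open>Comparison with radial barriers\<close>

text \<open>
  The problem solved by \<open>g = \<sigma> (z - Z)\<close>.  The positivity clause says that \<open>z > 0\<close>.
\<close>

definition pressure_deviation ::
  "real \<Rightarrow> real \<Rightarrow> real \<Rightarrow> ereal \<Rightarrow> ('a::euclidean_space \<Rightarrow> real \<Rightarrow> real) \<Rightarrow> bool" where
  "pressure_deviation D k \<sigma> T g \<longleftrightarrow>
     continuous_on (UNIV \<times> {t. 0 \<le> t \<and> ereal t < T}) (\<lambda>(x, t). g x t) \<and>
     (\<forall>x t. 0 \<le> t \<and> ereal t < T \<longrightarrow> 0 < bpress D x + \<sigma> * g x t) \<and>
     (\<forall>x t. 0 < t \<and> ereal t < T \<longrightarrow>
        (\<exists>gt p q. ((\<lambda>s. g x s) has_real_derivative gt) (at t) \<and>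
           (\<forall>b\<in>Basis. jet2 (\<lambda>y. g y t) x b (p b) (q b)) \<and>
           gt = (bpress D x + \<sigma> * g x t) * (\<Sum>b\<in>Basis. q b)
                - 2 * k * (\<Sum>b\<in>Basis. (x \<bullet> b) * p b) - \<sigma> * k * (\<Sum>b\<in>Basis. (p b)\<^sup>2)))"

lemma pressure_deviation_pos:
  assumes "pressure_deviation D k \<sigma> T g" "0 \<le> t" "ereal t < T"
  shows "0 < bpress D x + \<sigma> * g x t"
  using assms unfolding pressure_deviation_def by simp

lemma pressure_deviation_equation:
  assumes "pressure_deviation D k \<sigma> T g" "0 < t" "ereal t < T"
  obtains gt p q where "((\<lambda>s. g x s) has_real_derivative gt) (at t)"
    "\<And>b. b \<in> Basis \<Longrightarrow> jet2 (\<lambda>y. g y t) x b (p b) (q b)"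
    "gt = (bpress D x + \<sigma> * g x t) * (\<Sum>b\<in>Basis. q b)
                - 2 * k * (\<Sum>b\<in>Basis. (x \<bullet> b) * p b) - \<sigma> * k * (\<Sum>b\<in>Basis. (p b)\<^sup>2)"
proof -
  from assms(1)[unfolded pressure_deviation_def, THEN conjunct2, THEN conjunct2, rule_format, of t x]
  show ?thesis using assms(2,3) that by auto
qed

lemma sum_Basis_inner_square:
  fixes x :: "'a::euclidean_space"
  shows "(\<Sum>b\<in>Basis. (x \<bullet> b)\<^sup>2) = (norm x)\<^sup>2"
  unfolding power2_norm_eq_inner euclidean_inner[of x x] by (simp add: power2_eq_square)

text \<open>
  The comparison principle behind all bounds.  At the first time at which \<open>g\<close> touches the barrier, the
  touching point is interior to the shell, and there the gradients agree, the Hessians are ordered along the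
  coordinate directions and \<open>g\<^sub>t\<close> is at most the time derivative of the barrier.  As the coefficient
  \<open>Z + \<sigma>g\<close> is positive, the barrier cannot be a strict subsolution at that point.  The
  inequality \<open>strict\<close> may use that the two functions agree; this gives access to
  the sign and the size of the barrier in the applications.
\<close>

lemma radial_barrier:
  fixes g :: "'a::euclidean_space \<Rightarrow> real \<Rightarrow> real"
  assumes dev: "pressure_deviation D k \<sigma> T g"
    and t0: "ereal t0 < T"
    and J: "open J" "\<And>x::'a. A \<le> bpress D x \<Longrightarrow> bpress D x \<le> B \<Longrightarrow> bpress D x \<in> J"
    and F1: "\<And>r. r \<in> J \<Longrightarrow> (F has_real_derivative F1 r) (at r)"
    and F2: "\<And>r. r \<in> J \<Longrightarrow> (F1 has_real_derivative F2 r) (at r)"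
    and init: "\<And>x. A \<le> bpress D x \<Longrightarrow> bpress D x \<le> B \<Longrightarrow> c0 * F (bpress D x) < g x 0"
    and bdry: "\<And>x t. bpress D x = A \<or> bpress D x = B \<Longrightarrow> 0 \<le> t \<Longrightarrow> t \<le> t0 \<Longrightarrow>
                 c0 * exp (\<kappa> * t) * F (bpress D x) < g x t"
    and strict: "\<And>x t r c. r = bpress D x \<Longrightarrow> c = c0 * exp (\<kappa> * t) \<Longrightarrow> A < r \<Longrightarrow> r < B \<Longrightarrow>
        0 < t \<Longrightarrow> t \<le> t0 \<Longrightarrow> g x t = c * F r \<Longrightarrow>
        \<kappa> * c * F r < (r + \<sigma> * c * F r) * (c * (2 * real DIM('a) * F1 r + 4 * (r - D) * F2 r))
            - 4 * k * (r - D) * (c * F1 r) - 4 * \<sigma> * k * (r - D) * (c * F1 r)\<^sup>2"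
    and x: "A \<le> bpress D x" "bpress D x \<le> B" and t: "0 \<le> t" "t \<le> t0"
  shows "c0 * exp (\<kappa> * t) * F (bpress D x) < g x t"
proof (rule ccontr)
  assume neg: "\<not> c0 * exp (\<kappa> * t) * F (bpress D x) < g x t"
  define w where "w = (\<lambda>x t. g x t - c0 * exp (\<kappa> * t) * F (bpress D x))"
  define S where "S = {x::'a. A \<le> bpress D x \<and> bpress D x \<le> B}"
  have "closed S" unfolding S_def
    by (intro closed_Collect_conj closed_Collect_le continuous_intros)
  moreover have "bounded S"
  proof (rule boundedI[of _ "sqrt \<bar>B - D\<bar>"])
    fix x assume "x \<in> S"
    then have "(norm x)\<^sup>2 \<le> \<bar>B - D\<bar>" by (auto simp: S_def bpress_def)
    then show "norm x \<le> sqrt \<bar>B - D\<bar>" by (simp add: real_le_rsqrt)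
  qed
  ultimately have "compact S" by (simp add: compact_eq_bounded_closed)
  then have cQ: "compact (S \<times> {0..t0})" by (intro compact_Times) auto
  have sub: "S \<times> {0..t0} \<subseteq> UNIV \<times> {t. 0 \<le> t \<and> ereal t < T}"
    using t0 by (auto intro: le_less_trans[of "ereal _" "ereal t0"])
  have cF: "continuous_on J F" using F1 by (meson DERIV_isCont continuous_at_imp_continuous_on)
  have cw: "continuous_on (S \<times> {0..t0}) (\<lambda>(x, t). w x t)"
    unfolding w_def split_def
  proof (intro continuous_intros)
    show "continuous_on (S \<times> {0..t0}) (\<lambda>y. g (fst y) (snd y))"
      using dev sub unfolding pressure_deviation_def split_def by (meson continuous_on_subset)
    show "continuous_on (S \<times> {0..t0}) (\<lambda>y. F (bpress D (fst y)))"
      by (rule continuous_on_compose2[OF cF]) (use J(2) in \<open>auto intro!: continuous_intros simp: S_def\<close>)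
  qed
  \<comment> \<open>The touching point is a point of this compact set with minimal time.\<close>
  define Bad where "Bad = {y \<in> S \<times> {0..t0}. (\<lambda>(x, t). w x t) y \<le> 0}"
  have "Bad = (S \<times> {0..t0}) \<inter> (\<lambda>(x, t). w x t) -` {..0}" by (auto simp: Bad_def)
  then have "closed Bad"
    using continuous_closed_preimage[OF cw compact_imp_closed[OF cQ] closed_atMost] by simp
  moreover have "Bad \<subseteq> S \<times> {0..t0}" by (auto simp: Bad_def)
  ultimately have "compact Bad" using cQ by (metis compact_Int_closed inf.absorb_iff2)
  moreover have "(x, t) \<in> Bad" using neg x t by (auto simp: Bad_def S_def w_def)
  ultimately obtain y where y: "y \<in> Bad" "\<And>y'. y' \<in> Bad \<Longrightarrow> snd y \<le> snd y'"
    using continuous_attains_inf[of Bad snd] by (force intro: continuous_intros)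
  obtain x1 t1 where y1: "y = (x1, t1)" by fastforce
  have S1: "x1 \<in> S" "0 \<le> t1" "t1 \<le> t0" "w x1 t1 \<le> 0" using y(1) y1 by (auto simp: Bad_def)
  have before: "w x' s > 0" if "x' \<in> S" "0 \<le> s" "s < t1" for x' s
    using y(2)[of "(x', s)"] that S1 y1 by (force simp: Bad_def)
  have "t1 \<noteq> 0" using init[of x1] S1 by (auto simp: S_def w_def)
  then have t1: "0 < t1" using S1 by simp
  have at: "w x' t1 \<ge> 0" if "x' \<in> S" for x'
  proof -
    have "continuous_on {0..t0} (\<lambda>s. w x' s)"
      using continuous_on_compose2[OF cw, of "{0..t0}" "\<lambda>s. (x', s)"] that
      by (force intro!: continuous_intros)
    then have "continuous_on {0..t1} (\<lambda>s. w x' s)" using S1 by (auto elim: continuous_on_subset)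
    then have "((\<lambda>s. w x' s) \<longlongrightarrow> w x' t1) (at t1 within {0..t1})"
      using t1 by (simp add: continuous_on_def)
    then have "((\<lambda>s. w x' s) \<longlongrightarrow> w x' t1) (at_left t1)"
      using at_within_Icc_at_left[OF t1] by simp
    moreover have "\<forall>\<^sub>F s in at_left t1. 0 \<le> w x' s"
      using eventually_at_left_real[OF t1] by eventually_elim (auto intro!: less_imp_le before that)
    ultimately show ?thesis by (simp add: tendsto_lowerbound)
  qed
  have w0: "w x1 t1 = 0" using at S1 by force
  have int: "A < bpress D x1" "bpress D x1 < B"
    using bdry[of x1 t1] S1 by (auto simp: S_def w_def less_le)
  define r where "r = bpress D x1"
  define c where "c = c0 * exp (\<kappa> * t1)"
  have rJ: "r \<in> J" using J(2)[of x1] int by (simp add: r_def)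
  have t1T: "ereal t1 < T" using S1 t0 by (auto intro: le_less_trans[of "ereal t1" "ereal t0"])
  obtain gt p q where gt: "((\<lambda>s. g x1 s) has_real_derivative gt) (at t1)"
    and pq: "\<And>b. b \<in> Basis \<Longrightarrow> jet2 (\<lambda>y. g y t1) x1 b (p b) (q b)"
    and gt_eq: "gt = (bpress D x1 + \<sigma> * g x1 t1) * (\<Sum>b\<in>Basis. q b)
                - 2 * k * (\<Sum>b\<in>Basis. (x1 \<bullet> b) * p b) - \<sigma> * k * (\<Sum>b\<in>Basis. (p b)\<^sup>2)"
    using pressure_deviation_equation[OF dev t1 t1T, of x1] by auto
  have wt: "((\<lambda>s. w x1 s) has_real_derivative gt - \<kappa> * c * F r) (at t1)"
    unfolding w_def r_def c_def by (auto intro!: derivative_eq_intros gt)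
  \<comment> \<open>Before the touching time \<open>w\<close> is positive, so it cannot be increasing there.\<close>
  have gtle: "gt - \<kappa> * c * F r \<le> 0"
  proof (rule ccontr)
    assume "\<not> ?thesis"
    then obtain d where d: "d > 0" "\<And>h. h > 0 \<Longrightarrow> h < d \<Longrightarrow> w x1 (t1 - h) < w x1 t1"
      using DERIV_pos_inc_left[OF wt] by auto
    define h where "h = min d t1 / 2"
    have "0 < h" "h < d" "h < t1" using d t1 by (auto simp: h_def)
    then show False using d(2)[of h] before[of x1 "t1 - h"] w0 S1 by auto
  qed
  have jets: "p b = 2 * c * F1 r * (x1 \<bullet> b)"
    "q b \<ge> c * (4 * F2 r * (x1 \<bullet> b)\<^sup>2 + 2 * F1 r)" if b: "b \<in> Basis" for b
  proof -
    have "jet2 (\<lambda>y. g y t1 - c * F (bpress D y)) x1 b (p b - 2 * c * F1 r * (x1 \<bullet> b))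
           (q b - c * (4 * F2 r * (x1 \<bullet> b)\<^sup>2 + 2 * F1 r))"
      unfolding r_def
      by (intro jet2_diff pq b jet2_radial[of J]) (use J rJ F1 F2 in \<open>auto simp: r_def\<close>)
    moreover have "\<forall>\<^sub>F s in nhds 0. g x1 t1 - c * F (bpress D x1)
         \<le> g (x1 + s *\<^sub>R b) t1 - c * F (bpress D (x1 + s *\<^sub>R b))"
    proof -
      have "\<forall>\<^sub>F s in nhds 0. bpress D (x1 + s *\<^sub>R b) \<in> {A<..<B}"
        by (rule topological_tendstoD[OF bpress_line_tendsto]) (use int in auto)
      then show ?thesis
      proof eventually_elim
        case (elim s)
        then have "w (x1 + s *\<^sub>R b) t1 \<ge> 0" by (intro at) (auto simp: S_def)
        then show ?case using w0 by (simp add: w_def c_def)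
      qed
    qed
    ultimately have "p b - 2 * c * F1 r * (x1 \<bullet> b) = 0" "q b - c * (4 * F2 r * (x1 \<bullet> b)\<^sup>2 + 2 * F1 r) \<ge> 0"
      by (rule jet2_local_min)+
    then show "p b = 2 * c * F1 r * (x1 \<bullet> b)" "q b \<ge> c * (4 * F2 r * (x1 \<bullet> b)\<^sup>2 + 2 * F1 r)" by auto
  qed
  have geq: "g x1 t1 = c * F r" using w0 by (simp add: w_def c_def r_def)
  have rD: "(norm x1)\<^sup>2 = r - D" by (simp add: r_def bpress_def)
  have sp: "(\<Sum>b\<in>Basis. (x1 \<bullet> b) * p b) = 2 * (r - D) * (c * F1 r)"
  proof -
    have "(\<Sum>b\<in>Basis. (x1 \<bullet> b) * p b) = (\<Sum>b\<in>Basis. 2 * c * F1 r * (x1 \<bullet> b)\<^sup>2)"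
      by (rule sum.cong) (auto simp: jets power2_eq_square)
    also have "\<dots> = 2 * c * F1 r * (r - D)" by (simp only: sum_distrib_left[symmetric] sum_Basis_inner_square rD)
    finally show ?thesis by simp
  qed
  have sp2: "(\<Sum>b\<in>Basis. (p b)\<^sup>2) = 4 * (r - D) * (c * F1 r)\<^sup>2"
  proof -
    have "(\<Sum>b\<in>Basis. (p b)\<^sup>2) = (\<Sum>b\<in>Basis. (2 * c * F1 r)\<^sup>2 * (x1 \<bullet> b)\<^sup>2)"
      by (rule sum.cong) (auto simp: jets power_mult_distrib)
    also have "\<dots> = (2 * c * F1 r)\<^sup>2 * (r - D)" by (simp only: sum_distrib_left[symmetric] sum_Basis_inner_square rD)
    finally show ?thesis by (simp add: power_mult_distrib)
  qed
  have sq: "(\<Sum>b\<in>Basis. q b) \<ge> c * (2 * real DIM('a) * F1 r + 4 * (r - D) * F2 r)"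
  proof -
    have "c * (2 * real DIM('a) * F1 r + 4 * (r - D) * F2 r)
        = (\<Sum>b\<in>(Basis::'a set). (4 * c * F2 r) * (x1 \<bullet> b)\<^sup>2) + (\<Sum>b\<in>(Basis::'a set). 2 * c * F1 r)"
      by (simp only: sum_distrib_left[symmetric] sum_Basis_inner_square rD sum_constant) (simp add: algebra_simps)
    also have "\<dots> = (\<Sum>b\<in>(Basis::'a set). c * (4 * F2 r * (x1 \<bullet> b)\<^sup>2 + 2 * F1 r))"
      unfolding sum.distrib[symmetric] by (rule sum.cong) (auto simp: algebra_simps)
    also have "\<dots> \<le> (\<Sum>b\<in>Basis. q b)" by (rule sum_mono) (rule jets)
    finally show ?thesis .
  qed
  have st: "\<kappa> * c * F r < (r + \<sigma> * c * F r) * (c * (2 * real DIM('a) * F1 r + 4 * (r - D) * F2 r))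
            - 4 * k * (r - D) * (c * F1 r) - 4 * \<sigma> * k * (r - D) * (c * F1 r)\<^sup>2"
    by (rule strict[OF r_def c_def]) (use int t1 S1 geq in \<open>auto simp: r_def\<close>)
  have pos: "0 \<le> r + \<sigma> * c * F r"
    using pressure_deviation_pos[OF dev S1(2) t1T, of x1] geq by (simp add: r_def mult.assoc)
  have "\<kappa> * c * F r < (r + \<sigma> * c * F r) * (\<Sum>b\<in>Basis. q b)
            - 4 * k * (r - D) * (c * F1 r) - 4 * \<sigma> * k * (r - D) * (c * F1 r)\<^sup>2"
    using st mult_left_mono[OF sq pos] by linarith
  also have "\<dots> = gt"
    unfolding gt_eq sp sp2 geq r_def[symmetric] by (simp add: algebra_simps)
  finally show False using gtle by simp
qed

section \<open>The equation for the deviation of the pressure\<close>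

lemma line_derivative:
  assumes "F differentiable (at (x + s *\<^sub>R b))"
  shows "((\<lambda>r. F (x + r *\<^sub>R b)) has_vector_derivative frechet_derivative F (at (x + s *\<^sub>R b)) b) (at s)"
proof -
  let ?F' = "frechet_derivative F (at (x + s *\<^sub>R b))"
  have F: "(F has_derivative ?F') (at (x + s *\<^sub>R b))"
    using assms frechet_derivative_works by blast
  have "((\<lambda>r. x + r *\<^sub>R b) has_derivative (\<lambda>r. r *\<^sub>R b)) (at s)"
    by (auto intro!: derivative_eq_intros)
  from has_derivative_compose[OF this F]
  have "((\<lambda>r. F (x + r *\<^sub>R b)) has_derivative (\<lambda>r. ?F' (r *\<^sub>R b))) (at s)" .
  then show ?thesis
    unfolding has_vector_derivative_def
    using linear_cmul[OF has_derivative_linear[OF F]] by simp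
qed

lemma grad_inner_Basis:
  assumes "b \<in> Basis"
  shows "grad f x \<bullet> b = frechet_derivative f (at x) b"
  using assms by (simp add: grad_def inner_sum_left inner_Basis if_distrib sum.delta cong: if_cong)

lemma line_derivative_real:
  fixes f :: "'a::euclidean_space \<Rightarrow> real"
  assumes "f differentiable (at (x + s *\<^sub>R b))" "b \<in> Basis"
  shows "((\<lambda>r. f (x + r *\<^sub>R b)) has_real_derivative grad f (x + s *\<^sub>R b) \<bullet> b) (at s)"
  using line_derivative[OF assms(1)] assms(2)
  by (simp add: has_real_derivative_iff_has_vector_derivative grad_inner_Basis)

lemma line_derivative_component:
  fixes F :: "'a::euclidean_space \<Rightarrow> 'a"
  assumes "F differentiable (at x)"
  shows "((\<lambda>s. F (x + s *\<^sub>R b) \<bullet> b) has_real_derivative frechet_derivative F (at x) b \<bullet> b) (at 0)"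
  using bounded_linear.has_vector_derivative[OF bounded_linear_inner_left line_derivative[of F x 0 b]] assms
  by (simp add: has_real_derivative_iff_has_vector_derivative)

lemma divergence_eqI:
  assumes "F differentiable (at x)"
    and "\<And>b. b \<in> Basis \<Longrightarrow> ((\<lambda>s. F (x + s *\<^sub>R b) \<bullet> b) has_real_derivative d b) (at 0)"
  shows "divergence F x = (\<Sum>b\<in>Basis. d b)"
  unfolding divergence_def
  by (rule sum.cong) (use assms DERIV_unique line_derivative_component in blast)+

lemma jet2_cmult: "jet2 f x b p q \<Longrightarrow> jet2 (\<lambda>y. c * f y) x b (c * p) (c * q)"
  unfolding jet2_def
  by (elim exE conjE, rule_tac x="\<lambda>s. c * f' s" in exI)
     (auto intro: DERIV_cmult elim: eventually_mono)

lemma jet2_bpress: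
  fixes x b :: "'a::euclidean_space"
  assumes "b \<in> Basis"
  shows "jet2 (bpress D) x b (2 * (x \<bullet> b)) 2"
  using jet2_radial[of UNIV D x b "\<lambda>r. r" "\<lambda>_. 1" "\<lambda>_. 0" 1] assms by simp

context
  fixes V :: "'a::euclidean_space \<Rightarrow> real" and x :: 'a
  assumes pos: "\<And>y. V y > 0"
    and diff: "\<And>y. V differentiable (at y)" and gdiff: "grad V differentiable (at x)"
begin

lemma powr_line_derivative:
  assumes "b \<in> Basis"
  shows "((\<lambda>r. V (x + r *\<^sub>R b) powr a) has_real_derivative
           a * V (x + s *\<^sub>R b) powr (a - 1) * (grad V (x + s *\<^sub>R b) \<bullet> b)) (at s)"
  using DERIV_fun_powr[OF line_derivative_real[OF diff assms] pos] by (simp add: mult_ac)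

lemma jet2_powr:
  assumes b: "b \<in> Basis"
  shows "jet2 (\<lambda>y. V y powr a) x b (a * V x powr (a - 1) * (grad V x \<bullet> b))
     (a * (a - 1) * V x powr (a - 2) * (grad V x \<bullet> b)\<^sup>2
        + a * V x powr (a - 1) * (frechet_derivative (grad V) (at x) b \<bullet> b))"
  unfolding jet2_def
proof (intro exI[of _ "\<lambda>s. a * V (x + s *\<^sub>R b) powr (a - 1) * (grad V (x + s *\<^sub>R b) \<bullet> b)"] conjI)
  show "\<forall>\<^sub>F s in nhds 0. ((\<lambda>r. V (x + r *\<^sub>R b) powr a) has_real_derivative
           a * V (x + s *\<^sub>R b) powr (a - 1) * (grad V (x + s *\<^sub>R b) \<bullet> b)) (at s)"
    using powr_line_derivative[OF b] by simp
  show "((\<lambda>s. a * V (x + s *\<^sub>R b) powr (a - 1) * (grad V (x + s *\<^sub>R b) \<bullet> b)) has_real_derivative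
     (a * (a - 1) * V x powr (a - 2) * (grad V x \<bullet> b)\<^sup>2
        + a * V x powr (a - 1) * (frechet_derivative (grad V) (at x) b \<bullet> b))) (at 0)"
    by (rule DERIV_cong[OF DERIV_mult[OF DERIV_cmult[OF powr_line_derivative[OF b]] line_derivative_component[OF gdiff]]])
       (simp add: power2_eq_square algebra_simps)
qed simp

lemma divergence_flux:
  "divergence (\<lambda>y. V y powr a *\<^sub>R grad V y) x
     = (\<Sum>b\<in>Basis. a * V x powr (a - 1) * (grad V x \<bullet> b)\<^sup>2
          + V x powr a * (frechet_derivative (grad V) (at x) b \<bullet> b))"
proof (rule divergence_eqI)
  have "(\<lambda>y. V y powr a) differentiable (at x)"
    using has_derivative_powr[OF diff[of x, THEN frechet_derivative_works[THEN iffD1]] has_derivative_const pos]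
    unfolding differentiable_def by auto
  then show "(\<lambda>y. V y powr a *\<^sub>R grad V y) differentiable (at x)"
    using gdiff by (rule differentiable_scaleR)
  fix b :: 'a assume b: "b \<in> Basis"
  show "((\<lambda>s. (V (x + s *\<^sub>R b) powr a *\<^sub>R grad V (x + s *\<^sub>R b)) \<bullet> b) has_real_derivative
     a * V x powr (a - 1) * (grad V x \<bullet> b)\<^sup>2
          + V x powr a * (frechet_derivative (grad V) (at x) b \<bullet> b)) (at 0)"
    unfolding inner_scaleR_left
    by (rule DERIV_cong[OF DERIV_mult[OF powr_line_derivative[OF b] line_derivative_component[OF gdiff]]])
       (simp add: power2_eq_square algebra_simps)
qed

lemma divergence_drift:
  "divergence (\<lambda>y. V y *\<^sub>R y) x = (\<Sum>b\<in>Basis. (x \<bullet> b) * (grad V x \<bullet> b)) + real DIM('a) * V x"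
proof -
  have "divergence (\<lambda>y. V y *\<^sub>R y) x = (\<Sum>b\<in>Basis. (x \<bullet> b) * (grad V x \<bullet> b) + V x)"
  proof (rule divergence_eqI)
    show "(\<lambda>y. V y *\<^sub>R y) differentiable (at x)"
      by (intro differentiable_scaleR diff) simp
    fix b :: 'a assume b: "b \<in> Basis"
    have "((\<lambda>s. (x + s *\<^sub>R b) \<bullet> b) has_real_derivative 1) (at 0)"
      unfolding inner_add_left inner_scaleR_left using b by (auto intro!: derivative_eq_intros)
    from DERIV_mult[OF line_derivative_real[OF diff b] this]
    show "((\<lambda>s. (V (x + s *\<^sub>R b) *\<^sub>R (x + s *\<^sub>R b)) \<bullet> b) has_real_derivative
        (x \<bullet> b) * (grad V x \<bullet> b) + V x) (at 0)"
      unfolding inner_scaleR_left by (rule DERIV_cong) simp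
  qed
  then show ?thesis by (simp add: sum.distrib)
qed

end

text \<open>
  The chain rule for \<open>z = v\<^bsup>m-1\<^esup>\<close>.  The terms \<open>2nz\<close> cancel because
  \<open>Z \<Delta>Z - k |\<nabla>Z|\<^sup>2 + 2k x\<cdot>\<nabla>Z = 2nZ\<close>, and \<open>\<sigma>\<^sup>2 = 1\<close> allows both signs to be treated together.
\<close>

lemma pressure_deviation_of_solution:
  fixes v :: "'a::euclidean_space \<Rightarrow> real \<Rightarrow> real"
  assumes m: "m < 1" and sol: "positive_classical_solution m T v" and \<sigma>: "\<sigma> = 1 \<or> \<sigma> = -1"
  shows "pressure_deviation D (1 / (1 - m)) \<sigma> T (\<lambda>x t. \<sigma> * (v x t powr (m - 1) - bpress D x))"
  unfolding pressure_deviation_def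
proof (intro conjI allI impI)
  let ?Q = "UNIV \<times> {t. 0 \<le> t \<and> ereal t < T}"
  note sol' = sol[unfolded positive_classical_solution_def Let_def]
  have pos: "v x t > 0" if "0 \<le> t" "ereal t < T" for x t using sol' that by blast
  have cont: "continuous_on ?Q (\<lambda>y. v (fst y) (snd y))" using sol' by (simp add: split_def)
  show "continuous_on ?Q (\<lambda>(x, t). \<sigma> * (v x t powr (m - 1) - bpress D x))"
    unfolding split_def
    by (intro continuous_intros cont) (use pos in \<open>auto simp: less_imp_neq[THEN not_sym]\<close>)
  have ss: "\<sigma> * \<sigma> = 1" using \<sigma> by auto
  then have ss': "\<sigma> * (\<sigma> * a) = a" for a by (metis mult.assoc mult_1)
  show "0 < bpress D x + \<sigma> * (\<sigma> * (v x t powr (m - 1) - bpress D x))" if "0 \<le> t \<and> ereal t < T" for x t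
    unfolding ss' using pos that by (simp add: less_imp_neq[symmetric])
  fix x :: 'a and t :: real assume t: "0 < t \<and> ereal t < T"
  define V where "V = (\<lambda>y. v y t)"
  have Vpos: "V y > 0" for y using pos t by (simp add: V_def)
  have Vdiff: "V differentiable (at y)" for y using sol' t by (auto simp: V_def)
  have Vgdiff: "grad V differentiable (at x)" using sol' t by (auto simp: V_def)
  define vt where "vt = deriv (\<lambda>s. v x s) t"
  have "(\<lambda>s. v x s) differentiable (at t)" using sol' t by auto
  then have vt: "((\<lambda>s. v x s) has_real_derivative vt) (at t)"
    unfolding vt_def by (simp add: DERIV_deriv_iff_real_differentiable)
  define k where "k = 1 / (1 - m)"
  have k: "k * (1 - m) = 1" using m by (simp add: k_def)
  define n where "n = real DIM('a)"
  define G where "G = (\<lambda>b. grad V x \<bullet> b)"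
  define H where "H = (\<lambda>b. frechet_derivative (grad V) (at x) b \<bullet> b)"
  \<comment> \<open>All powers of \<open>v\<close> that occur are \<open>W\<close> times \<open>1\<close>, \<open>v\<close> or \<open>v\<^sup>2\<close>; this makes the final identity polynomial.\<close>
  define W where "W = V x powr (m - 3)"
  have W: "V x powr (m - 2) = W * V x" "V x powr (m - 1) = W * V x * V x"
    "V x powr (m - 1 - 1) = W * V x" "V x powr (m - 1 - 2) = W"
    using powr_add[of "V x" "m - 3" 1] powr_add[of "V x" "m - 3" 2] Vpos[of x]
    by (simp_all add: W_def power2_eq_square)
  define zp where "zp = (\<lambda>b. (m - 1) * (W * V x) * G b)"
  define zq where "zq = (\<lambda>b. (m - 1) * (m - 2) * W * (G b)\<^sup>2 + (m - 1) * (W * V x) * H b)"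
  define p where "p = (\<lambda>b. \<sigma> * (zp b - 2 * (x \<bullet> b)))"
  define q where "q = (\<lambda>b. \<sigma> * (zq b - 2))"
  define P where "P = (\<Sum>b\<in>Basis. (G b)\<^sup>2)"
  define Q where "Q = (\<Sum>b\<in>Basis. H b)"
  define X where "X = (\<Sum>b\<in>Basis. (x \<bullet> b) * G b)"
  define R where "R = (norm x)\<^sup>2"
  have vt_eq: "vt = (m - 1) * (W * V x) * P + W * V x * V x * Q + 2 * k * (X + n * V x)"
  proof -
    have "vt = divergence (\<lambda>y. V y powr (m - 1) *\<^sub>R grad V y) x
           + fde_mu m * divergence (\<lambda>y. V y *\<^sub>R y) x"
      using sol' t unfolding V_def vt_def by auto
    then show ?thesis
      unfolding divergence_flux[OF Vpos Vdiff Vgdiff] divergence_drift[OF Vpos Vdiff Vgdiff] W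
        sum.distrib sum_distrib_left[symmetric] P_def Q_def X_def G_def H_def n_def fde_mu_def k_def
      by simp
  qed
  have jet: "jet2 (\<lambda>y. \<sigma> * (V y powr (m - 1) - bpress D y)) x b (p b) (q b)" if "b \<in> Basis" for b
  proof -
    have "jet2 (\<lambda>y. V y powr (m - 1)) x b (zp b) (zq b)"
      using jet2_powr[OF Vpos Vdiff Vgdiff that, of "m - 1"] unfolding W zp_def zq_def G_def H_def by simp
    from jet2_cmult[OF jet2_diff[OF this jet2_bpress[OF that]]] show ?thesis
      by (simp add: p_def q_def)
  qed
  have dt: "((\<lambda>s. \<sigma> * (v x s powr (m - 1) - bpress D x)) has_real_derivative
       \<sigma> * ((m - 1) * (W * V x) * vt)) (at t)"
  proof -
    have "((\<lambda>s. v x s powr (m - 1)) has_real_derivative (m - 1) * (W * V x) * vt) (at t)"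
      using DERIV_fun_powr[OF vt, of "m - 1"] Vpos[of x] W by (simp add: V_def)
    from DERIV_cmult[OF DERIV_diff[OF this DERIV_const]] show ?thesis by simp
  qed
  have sq: "(\<Sum>b\<in>Basis. q b) = \<sigma> * ((m - 1) * (m - 2) * W * P + (m - 1) * (W * V x) * Q - 2 * n)"
    unfolding q_def zq_def sum_distrib_left[symmetric] sum_subtractf sum.distrib P_def Q_def n_def by simp
  have sxp: "(\<Sum>b\<in>Basis. (x \<bullet> b) * p b) = \<sigma> * ((m - 1) * (W * V x) * X - 2 * R)"
  proof -
    have "(\<Sum>b\<in>Basis. (x \<bullet> b) * p b)
        = (\<Sum>b\<in>Basis. \<sigma> * ((m - 1) * (W * V x) * ((x \<bullet> b) * G b) - 2 * (x \<bullet> b)\<^sup>2))"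
      by (rule sum.cong) (auto simp: p_def zp_def power2_eq_square algebra_simps)
    then show ?thesis
      unfolding sum_distrib_left[symmetric] sum_subtractf X_def R_def sum_Basis_inner_square[symmetric] by simp
  qed
  have spp: "(\<Sum>b\<in>Basis. (p b)\<^sup>2)
      = ((m - 1) * (W * V x))\<^sup>2 * P - 4 * ((m - 1) * (W * V x)) * X + 4 * R"
  proof -
    have "(p b)\<^sup>2 = ((m - 1) * (W * V x))\<^sup>2 * (G b)\<^sup>2
        - 4 * ((m - 1) * (W * V x)) * ((x \<bullet> b) * G b) + 4 * (x \<bullet> b)\<^sup>2" for b
    proof -
      have "(p b)\<^sup>2 = (zp b - 2 * (x \<bullet> b))\<^sup>2"
        unfolding p_def power_mult_distrib by (simp add: power2_eq_square ss)
      then show ?thesis by (simp add: zp_def power2_eq_square algebra_simps)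
    qed
    then show ?thesis
      by (simp only: sum.distrib sum_subtractf sum_distrib_left[symmetric] P_def X_def R_def sum_Basis_inner_square)
  qed
  have alg: "\<sigma> * ((m - 1) * (W * V x) * vt)
     = (bpress D x + \<sigma> * (\<sigma> * (v x t powr (m - 1) - bpress D x))) * (\<Sum>b\<in>Basis. q b)
       - 2 * k * (\<Sum>b\<in>Basis. (x \<bullet> b) * p b) - \<sigma> * k * (\<Sum>b\<in>Basis. (p b)\<^sup>2)"
  proof -
    have z: "v x t powr (m - 1) = W * V x * V x" using W by (simp add: V_def)
    have m1: "m - 1 = - (1 - m)" "m - 2 = - (1 - m) - 1" by auto
    define j where "j = 1 - m"
    have kj: "k * j = 1" using k by (simp add: j_def)
    define U where "U = V x"
    have "- j * (W * U) * (- j * (W * U) * P + W * U * U * Q + 2 * k * (X + n * U))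
      = W * U * U * (- j * (- j - 1) * W * P + - j * (W * U) * Q - 2 * n)
        - 2 * k * (- j * (W * U) * X - 2 * R)
        - k * ((- j * (W * U))\<^sup>2 * P - 4 * (- j * (W * U)) * X + 4 * R)"
      using kj by algebra
    then show ?thesis
      unfolding sq sxp spp ss' vt_eq z unfolding m1 j_def[symmetric] U_def[symmetric] by algebra
  qed
  show "\<exists>gt p q. ((\<lambda>s. \<sigma> * (v x s powr (m - 1) - bpress D x)) has_real_derivative gt) (at t) \<and>
      (\<forall>b\<in>Basis. jet2 (\<lambda>y. \<sigma> * (v y t powr (m - 1) - bpress D y)) x b (p b) (q b)) \<and>
      gt = (bpress D x + \<sigma> * (\<sigma> * (v x t powr (m - 1) - bpress D x))) * (\<Sum>b\<in>Basis. q b)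
        - 2 * (1 / (1 - m)) * (\<Sum>b\<in>Basis. (x \<bullet> b) * p b) - \<sigma> * (1 / (1 - m)) * (\<Sum>b\<in>Basis. (p b)\<^sup>2)"
    using dt jet alg unfolding k_def V_def by blast
qed

section \<open>The profile as a stationary solution\<close>

lemma bpress_ge: "D \<le> bpress D x" by (simp add: bpress_def)

lemma bpress_has_derivative:
  "(bpress D has_derivative (\<lambda>h. 2 * (x \<bullet> h))) (at (x::'a::euclidean_space))"
  unfolding bpress_def[abs_def] power2_norm_eq_inner
  by (auto intro!: derivative_eq_intros simp: inner_commute)

lemma bpress_powr_has_derivative:
  assumes "D > 0"
  shows "((\<lambda>y. bpress D y powr a) has_derivative
           (\<lambda>h. a * bpress D x powr (a - 1) * (2 * (x \<bullet> h)))) (at (x::'a::euclidean_space))"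
proof -
  have p: "bpress D x > 0" using assms bpress_ge[of D x] by linarith
  show ?thesis
    by (rule has_derivative_eq_rhs[OF has_derivative_powr[OF bpress_has_derivative has_derivative_const p]])
       (use p in \<open>simp_all add: powr_diff field_simps\<close>)
qed

lemma grad_eqI:
  fixes f :: "'a::euclidean_space \<Rightarrow> real"
  assumes "(f has_derivative (\<lambda>h. G \<bullet> h)) (at x)"
  shows "grad f x = G"
  unfolding grad_def frechet_derivative_at[OF assms, symmetric] by (rule euclidean_representation)

lemma barenblatt_eq_powr: "barenblatt m D x = bpress D x powr (- 1 / (1 - m))"
  by (simp add: barenblatt_def bpress_def)

text \<open>
  The diffusive flux of the profile is \<open>V\<^sub>D\<^bsup>m-1\<^esup> \<nabla>V\<^sub>D = -\<mu> x V\<^sub>D\<close>, which the drift \<open>\<mu> x V\<^sub>D\<close> cancels before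
  the divergence is taken.
\<close>

lemma barenblatt_stationary:
  assumes D: "D > 0" and m: "m < 1"
  shows "positive_classical_solution m T (\<lambda>(x::'a::euclidean_space) t. barenblatt m D x)"
proof -
  define a where "a = - 1 / (1 - m)"
  let ?Z = "bpress D :: 'a \<Rightarrow> real"
  have Zp: "?Z x > 0" for x using D bpress_ge[of D x] by linarith
  have V: "barenblatt m D = (\<lambda>x. ?Z x powr a)" by (simp add: fun_eq_iff barenblatt_eq_powr a_def)
  have Vd: "((\<lambda>y. ?Z y powr a) has_derivative (\<lambda>h. ((2 * a * ?Z x powr (a - 1)) *\<^sub>R x) \<bullet> h)) (at x)" for x
    using bpress_powr_has_derivative[OF D, of a x] by (simp add: mult_ac)
  have G: "grad (\<lambda>y. ?Z y powr a) = (\<lambda>x. (2 * a * ?Z x powr (a - 1)) *\<^sub>R x)"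
    using grad_eqI[OF Vd] by blast
  define G' where "G' = (\<lambda>x h. (2 * a * ?Z x powr (a - 1)) *\<^sub>R h
      + (2 * a * ((a - 1) * ?Z x powr (a - 1 - 1) * (2 * (x \<bullet> h)))) *\<^sub>R (x::'a))"
  have Gd: "((\<lambda>x. (2 * a * ?Z x powr (a - 1)) *\<^sub>R x) has_derivative G' x) (at x)" for x
    unfolding G'_def
    by (rule has_derivative_eq_rhs[OF has_derivative_scaleR[OF has_derivative_mult_right[OF
          bpress_powr_has_derivative[OF D]] has_derivative_ident]]) simp
  have cZ: "continuous_on X (\<lambda>y. ?Z (f y) powr c)" if "continuous_on X f" for X :: "('a \<times> real) set" and f c
    by (intro continuous_intros that) (use Zp in \<open>auto simp: less_imp_neq[THEN not_sym]\<close>)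
  have flux: "(?Z x powr a) powr (m - 1) *\<^sub>R (2 * a * ?Z x powr (a - 1)) *\<^sub>R x
      = (- fde_mu m) *\<^sub>R (?Z x powr a *\<^sub>R x)" for x
  proof -
    have "a * (m - 1) = 1" using m by (simp add: a_def field_simps)
    then have "(?Z x powr a) powr (m - 1) * ?Z x powr (a - 1) = ?Z x powr a"
      using Zp[of x] powr_mult_base[of "?Z x" "a - 1"] by (simp add: powr_powr)
    then have "(?Z x powr a) powr (m - 1) * (2 * a * ?Z x powr (a - 1)) = 2 * a * ?Z x powr a"
      by (metis mult.left_commute)
    then show ?thesis by (simp add: fde_mu_def a_def)
  qed
  have div: "divergence (\<lambda>y. c *\<^sub>R (?Z y powr a *\<^sub>R y)) x = c * divergence (\<lambda>y. ?Z y powr a *\<^sub>R y) x" for c x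
  proof -
    have d: "(\<lambda>y. ?Z y powr a *\<^sub>R y) differentiable (at x)"
      by (intro differentiable_scaleR) (use Vd in \<open>auto simp: differentiable_def\<close>)
    have "frechet_derivative (\<lambda>y. c *\<^sub>R (?Z y powr a *\<^sub>R y)) (at x)
        = (\<lambda>h. c *\<^sub>R frechet_derivative (\<lambda>y. ?Z y powr a *\<^sub>R y) (at x) h)"
      by (rule frechet_derivative_at[OF has_derivative_scaleR_right, symmetric])
         (use d frechet_derivative_works in blast)
    then show ?thesis by (simp add: divergence_def sum_distrib_left)
  qed
  show ?thesis
    unfolding positive_classical_solution_def Let_def V G frechet_derivative_at[OF Gd, symmetric] flux div split_def
  proof (intro conjI ballI allI impI)
    show "\<And>x. 0 < ?Z x powr a" using Zp by (simp add: less_imp_neq[THEN not_sym])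
    show "(\<lambda>y. ?Z y powr a) differentiable (at x)" for x
      using Vd by (auto simp: differentiable_def)
    show "(\<lambda>x. (2 * a * ?Z x powr (a - 1)) *\<^sub>R x) differentiable (at x)" for x
      using Gd by (auto simp: differentiable_def)
  qed (auto simp: G'_def intro!: continuous_intros cZ)
qed

section \<open>Solutions below the profile stay below\<close>

text \<open>
  The barrier is \<open>-\<delta> e\<^bsup>Kt\<^esup> Z\<^sup>2\<close> on the ball \<open>Z \<le> 1/\<delta>\<close>.  On the boundary it lies below \<open>-Z < g\<close>.  At a touching
  point \<open>Z + g > 0\<close> reads \<open>\<delta> e\<^bsup>Kt\<^esup> Z < 1\<close>, so the quadratic terms are no larger than the linear ones, and
  both are absorbed by \<open>K\<close>.  Finally \<open>\<delta> \<rightarrow> 0\<close>.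
\<close>

lemma pressure_deviation_nonneg_below:
  fixes g :: "'a::euclidean_space \<Rightarrow> real \<Rightarrow> real"
  assumes D: "D > 0" and k: "k \<ge> 0" and dev: "pressure_deviation D k 1 T g"
    and init: "\<And>x. g x 0 \<ge> 0" and t: "0 \<le> t" "ereal t < T"
  shows "g x t \<ge> 0"
proof (rule ccontr)
  assume neg: "\<not> g x t \<ge> 0"
  define n where "n = real DIM('a)"
  define K where "K = 4 * n + 9 + 16 * k"
  define Z where "Z = bpress D x"
  have Z: "Z > 0" using D bpress_ge[of D x] by (simp add: Z_def)
  \<comment> \<open>Small enough for \<open>x\<close> to lie in the ball and for the barrier at \<open>x\<close> to contradict \<open>neg\<close>.\<close>
  define d where "d = min (1 / Z) (- g x t / (exp (K * t) * Z\<^sup>2))"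
  have d: "d > 0" using Z neg by (simp add: d_def divide_neg_pos)
  have "d \<le> 1 / Z" by (simp add: d_def)
  then have "Z * d \<le> 1" using Z by (simp add: pos_le_divide_eq mult.commute)
  then have dZ: "Z \<le> 1 / d" using d by (simp add: pos_le_divide_eq)
  have "- d * exp (K * t) * (bpress D x)\<^sup>2 < g x t"
  proof (rule radial_barrier[OF dev t(2), where A = 0 and B = "1 / d" and J = UNIV
        and F = "\<lambda>r. r\<^sup>2" and ?F1.0 = "\<lambda>r. 2 * r" and ?F2.0 = "\<lambda>_. 2"])
    show "- d * (bpress D y)\<^sup>2 < g y 0" for y
    proof -
      have "bpress D y > 0" using D bpress_ge[of D y] by linarith
      then have "d * (bpress D y)\<^sup>2 > 0" using d by simp
      then show ?thesis using init[of y] by simp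
    qed
    show "- d * exp (K * s) * (bpress D y)\<^sup>2 < g y s"
      if y: "bpress D y = 0 \<or> bpress D y = 1 / d" and s: "0 \<le> s" "s \<le> t" for y s
    proof -
      have "bpress D y > 0" using D bpress_ge[of D y] by linarith
      then have y: "bpress D y = 1 / d" using y by simp
      have "ereal s < T" using s t by (auto intro: le_less_trans[of "ereal s" "ereal t"])
      then have gt: "- bpress D y < g y s" using pressure_deviation_pos[OF dev s(1), of y] by simp
      have "exp (K * s) \<ge> 1" using s k by (simp add: K_def n_def)
      moreover have "d * exp (K * s) * (bpress D y)\<^sup>2 = exp (K * s) * bpress D y"
        unfolding y using d by (simp add: power2_eq_square)
      ultimately have "d * exp (K * s) * (bpress D y)\<^sup>2 \<ge> bpress D y"
        using mult_right_mono[of 1 "exp (K * s)" "bpress D y"] \<open>bpress D y > 0\<close> by linarith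
      then show ?thesis using gt by simp
    qed
    fix y s r c
    assume r: "r = bpress D y" and c: "c = - d * exp (K * s)" and s: "0 < s" "s \<le> t"
      and touch: "g y s = c * r\<^sup>2"
    define e where "e = - c"
    have e: "e > 0" using d c by (simp add: e_def)
    have rD: "D \<le> r" "0 < r" using D bpress_ge[of D y] r by simp_all
    have "ereal s < T" using s t by (auto intro: le_less_trans[of "ereal s" "ereal t"])
    then have "0 < r + 1 * g y s" using pressure_deviation_pos[OF dev less_imp_le[OF s(1)]] r by simp
    then have "e * r * r < 1 * r" using touch by (simp add: e_def power2_eq_square)
    then have er: "e * r < 1" using mult_less_cancel_right_pos[OF rD(2)] by blast
    have *: "(r - e * r\<^sup>2) * (4 * n * r + 8 * (r - D)) + 16 * k * (r - D) * (e * r\<^sup>2) - 8 * k * (r - D) * r < K * r\<^sup>2"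
    proof -
      have "(r - e * r\<^sup>2) * (4 * n * r + 8 * (r - D)) \<le> r * (4 * n * r + 8 * r)"
        by (rule mult_mono) (use e rD D in \<open>auto simp: n_def\<close>)
      moreover have "16 * k * ((r - D) * (e * r * r)) \<le> 16 * k * (r * (1 * r))"
        by (intro mult_left_mono mult_mono) (use e rD D er k in auto)
      moreover have "0 \<le> 8 * k * (r - D) * r" using k rD by simp
      moreover have "r\<^sup>2 > 0" using rD by simp
      ultimately show ?thesis unfolding K_def by (simp add: algebra_simps power2_eq_square)
    qed
    have "e * ((r - e * r\<^sup>2) * (4 * n * r + 8 * (r - D)) + 16 * k * (r - D) * (e * r\<^sup>2) - 8 * k * (r - D) * r)
        < e * (K * r\<^sup>2)"
      using * e by simp
    moreover have ce: "c = - e" by (simp add: e_def)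
    ultimately show "K * c * r\<^sup>2 < (r + 1 * c * r\<^sup>2) *
          (c * (2 * real DIM('a) * (2 * r) + 4 * (r - D) * 2)) -
          4 * k * (r - D) * (c * (2 * r)) - 4 * 1 * k * (r - D) * (c * (2 * r))\<^sup>2"
      unfolding ce n_def[symmetric] by (simp add: algebra_simps power2_eq_square)
  qed (use Z dZ t in \<open>auto simp: Z_def intro!: derivative_eq_intros\<close>)
  moreover have "d * (exp (K * t) * Z\<^sup>2) \<le> - g x t"
  proof -
    have "d \<le> - g x t / (exp (K * t) * Z\<^sup>2)" unfolding d_def by (rule min.cobounded2)
    moreover have "0 < exp (K * t) * Z\<^sup>2" using Z by simp
    ultimately show ?thesis by (simp only: pos_le_divide_eq)
  qed
  ultimately show False by (simp add: Z_def mult_ac)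
qed

section \<open>Solutions above the profile stay above\<close>

text \<open>
  The profile \<open>\<Phi> = (r\<^sup>q A)\<^sup>s\<close> grows like \<open>r\<^bsup>qs\<^esup>\<close> for \<open>r\<close> well below \<open>R\<close> and becomes infinite at \<open>R\<close>.
  With this \<open>A\<close> we have \<open>r (r\<^sup>q A)' = q A (r\<^sup>q A)\<close>, so both derivatives are multiples of \<open>\<Phi>\<close> by polynomials
  in \<open>A\<close>.
\<close>

lemma blowup_profile_deriv:
  fixes R r :: real and q s :: nat
  defines "A \<equiv> \<lambda>r. 1 / (1 - (r / R) ^ q)"
  defines "F \<equiv> \<lambda>r. (r ^ q * A r) ^ s"
  assumes r: "0 < r" "r < R" and qs: "0 < q" "0 < s"
  shows "(F has_real_derivative real s * real q * A r * F r / r) (at r)"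
    and "((\<lambda>r. real s * real q * A r * F r / r) has_real_derivative
           real s * real q * A r * (real q * (real s + 1) * A r - real q - 1) * F r / r\<^sup>2) (at r)"
proof -
  have lt: "(r / R) ^ q < 1" using r qs by (simp add: power_less_one_iff)
  then have ne: "1 - (r / R) ^ q \<noteq> 0" by simp
  have rq: "r ^ (q - 1) = r ^ q / r" "(r / R) ^ (q - 1) / R = (r / R) ^ q / r"
    using r qs by (simp_all add: power_eq_if field_simps)
  have AA: "(r / R) ^ q * A r = A r - 1" using ne by (simp add: A_def field_simps)
  have A': "(A has_real_derivative real q * A r * (A r - 1) / r) (at r)"
  proof -
    have "(A has_real_derivative (real q * ((r / R) ^ (q - 1) / R)) / (1 - (r / R) ^ q)\<^sup>2) (at r)"
      unfolding A_def using ne r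
      by (auto intro!: derivative_eq_intros simp: power2_eq_square)
    moreover have "(real q * ((r / R) ^ (q - 1) / R)) / (1 - (r / R) ^ q)\<^sup>2
        = real q * A r * ((r / R) ^ q * A r) / r"
      unfolding rq by (simp add: A_def power2_eq_square)
    ultimately show ?thesis by (simp add: AA)
  qed
  have G': "((\<lambda>r. r ^ q * A r) has_real_derivative real q * A r * (r ^ q * A r) / r) (at r)"
    by (rule DERIV_cong[OF DERIV_mult[OF DERIV_pow A']])
       (use r qs rq(1) in \<open>simp add: field_simps\<close>)
  have sp: "(r ^ q * A r) ^ (s - Suc 0) * (r ^ q * A r) = F r"
    unfolding F_def using qs by (metis Suc_pred power_Suc2)
  show F': "(F has_real_derivative real s * real q * A r * F r / r) (at r)"
  proof -
    have "((\<lambda>r. (r ^ q * A r) ^ s) has_real_derivative real s * real q * A r * F r / r) (at r)"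
      by (rule DERIV_cong[OF DERIV_power[OF G']]) (simp add: sp[symmetric] mult_ac)
    then show ?thesis unfolding F_def .
  qed
  show "((\<lambda>r. real s * real q * A r * F r / r) has_real_derivative
           real s * real q * A r * (real q * (real s + 1) * A r - real q - 1) * F r / r\<^sup>2) (at r)"
  proof (rule DERIV_cong[OF DERIV_divide[OF DERIV_mult[OF DERIV_cmult[OF A'] F'] DERIV_ident]])
    define i where "i = inverse r"
    have ri: "r * i = 1" using r by (simp add: i_def)
    show "((real s * real q * (real q * A r * (A r - 1) / r) * F r
          + real s * real q * A r * F r / r * (real s * real q * A r)) * r
        - real s * real q * A r * F r * 1) / (r * r)
      = real s * real q * A r * (real q * (real s + 1) * A r - real q - 1) * F r / r\<^sup>2"
      unfolding divide_inverse power2_eq_square inverse_mult_distrib i_def[symmetric]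
      using ri by algebra
  qed (use r in simp)
qed

text \<open>
  The supersolution inequality for \<open>\<eta> \<Phi>(Z)\<close>, divided by \<open>\<eta> \<Phi>\<close>, with \<open>y = \<eta> \<Phi> / Z\<close>, \<open>\<rho> = |x|\<^sup>2 / Z\<close>,
  \<open>e1 = Z \<Phi>' / \<Phi>\<close> and \<open>e2 = Z\<^sup>2 \<Phi>'' / \<Phi>\<close>.  The linear part is at most \<open>L A\<^sup>2\<close>.  The quadratic part, with factor
  \<open>y\<close>, contains \<open>e2 - k e1\<^sup>2\<close>, of order \<open>A\<^sup>2\<close> and negative since \<open>(k - 1) s \<ge> 2\<close>.  Hence, where \<open>A > 2\<close>, the quadratic part
  compensates the linear one as soon as \<open>y\<close> is large; where \<open>A \<le> 2\<close>, all terms are bounded and \<open>K\<close> compensates them.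
  Near the origin \<open>\<rho>\<close> is small and the quadratic part may be positive, but there \<open>y \<le> Y\<close>.
\<close>

lemma blowup_profile_inequality:
  fixes A y \<rho> k n q s :: real
  assumes A: "A \<ge> 1" and y: "y \<ge> 0" and \<rho>: "0 \<le> \<rho>" "\<rho> \<le> 1" and k: "(k - 1) * s \<ge> 2" "k \<ge> 0"
    and s: "s \<ge> 1" and n: "n \<ge> 1" and q: "q = 2 * n"
    and L: "L = 2 * n * s * q + 4 * s * (s + 1) * q\<^sup>2"
    and K: "K > 4 * L + 4 * n * s * q * Y" and Y: "Y \<ge> 0"
    and cs: "(A \<le> 2 \<and> y \<le> Y) \<or> (\<rho> \<ge> 1 / 2 \<and> (A \<le> 2 \<or> y \<ge> L / (2 * n * s * q)))"
    and e1: "e1 = s * q * A" and e2: "e2 = s * q * A * (q * (s + 1) * A - q - 1)"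
  shows "(1 + y) * (2 * n * e1 + 4 * \<rho> * e2) - 4 * k * \<rho> * e1 - 4 * k * \<rho> * y * e1\<^sup>2 < K"
proof -
  have sqp: "s * q > 0" "n * s * q > 0" using s q n by simp_all
  have Lp: "L > 0" unfolding L using s n q by (intro add_pos_pos mult_pos_pos) auto
  have AA: "A \<le> A\<^sup>2" using A by (simp add: power2_eq_square)
  have e2le: "e2 \<le> s * (s + 1) * q\<^sup>2 * A\<^sup>2"
  proof -
    have "s * q * A * (q * (s + 1) * A - q - 1) \<le> s * q * A * (q * (s + 1) * A)"
      by (rule mult_left_mono) (use sqp A q n in auto)
    then show ?thesis unfolding e2 by (simp add: power2_eq_square mult_ac)
  qed
  have lin: "2 * n * e1 + 4 * \<rho> * e2 - 4 * k * \<rho> * e1 \<le> L * A\<^sup>2"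
  proof -
    have "2 * n * e1 \<le> 2 * n * s * q * A\<^sup>2"
      using mult_left_mono[OF AA, of "2 * (n * s * q)"] sqp unfolding e1 by (simp add: mult_ac)
    moreover have "4 * \<rho> * e2 \<le> 4 * (s * (s + 1) * q\<^sup>2 * A\<^sup>2)"
    proof -
      have "\<rho> * e2 \<le> \<rho> * (s * (s + 1) * q\<^sup>2 * A\<^sup>2)" by (rule mult_left_mono[OF e2le \<rho>(1)])
      also have "\<dots> \<le> 1 * (s * (s + 1) * q\<^sup>2 * A\<^sup>2)"
        by (rule mult_right_mono[OF \<rho>(2)]) (use s in auto)
      finally show ?thesis by simp
    qed
    moreover have "4 * k * \<rho> * e1 \<ge> 0" unfolding e1 using k \<rho> s n q A by (intro mult_nonneg_nonneg) auto
    ultimately show ?thesis unfolding L by (simp add: algebra_simps)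
  qed
  define N where "N = 2 * n * s * q * A * (1 - 4 * \<rho> * A)"
  have quad: "2 * n * e1 + 4 * \<rho> * e2 - 4 * k * \<rho> * e1\<^sup>2 \<le> N"
  proof -
    have "4 * \<rho> * e2 - 4 * k * \<rho> * e1\<^sup>2 \<le> 4 * \<rho> * (s * (s + 1) * q\<^sup>2 * A\<^sup>2) - 4 * k * \<rho> * e1\<^sup>2"
      using mult_left_mono[OF e2le \<rho>(1)] by simp
    also have "\<dots> = 4 * (\<rho> * s * q\<^sup>2 * A\<^sup>2) * (s + 1 - k * s)"
      unfolding e1 by (simp add: power2_eq_square algebra_simps)
    also have "\<dots> \<le> 4 * (\<rho> * s * q\<^sup>2 * A\<^sup>2) * (- 1)"
      by (rule mult_left_mono) (use \<rho> s k in \<open>auto simp: algebra_simps\<close>)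
    finally show ?thesis unfolding N_def e1 q by (simp add: power2_eq_square algebra_simps)
  qed
  have tot: "(1 + y) * (2 * n * e1 + 4 * \<rho> * e2) - 4 * k * \<rho> * e1 - 4 * k * \<rho> * y * e1\<^sup>2 \<le> L * A\<^sup>2 + y * N"
    using lin mult_left_mono[OF quad y] by (simp add: algebra_simps)
  have A4: "L * A\<^sup>2 \<le> 4 * L" if "A \<le> 2"
  proof -
    have "A\<^sup>2 \<le> 2\<^sup>2" using that A by (intro power_mono) auto
    then show ?thesis using Lp by simp
  qed
  have NA: "N \<le> - (2 * n * s * q * A\<^sup>2)" if \<rho>2: "\<rho> \<ge> 1 / 2"
  proof -
    have "2 * A \<le> 4 * \<rho> * A" using \<rho>2 A by (intro mult_right_mono) auto
    then have "1 - 4 * \<rho> * A \<le> - A" using A by linarith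
    then have "A * (1 - 4 * \<rho> * A) \<le> A * (- A)" using A by (intro mult_left_mono) auto
    from mult_left_mono[OF this, of "2 * (n * s * q)"]
    have "2 * (n * s * q) * (A * (1 - 4 * \<rho> * A)) \<le> 2 * (n * s * q) * (A * (- A))"
      using sqp by linarith
    then show ?thesis unfolding N_def by (simp add: mult.assoc power2_eq_square)
  qed
  have pY: "0 \<le> 4 * n * s * q * Y" using n s q Y by (intro mult_nonneg_nonneg) auto
  have "L * A\<^sup>2 + y * N < K"
    using cs
  proof (elim disjE conjE)
    assume A2: "A \<le> 2" and yY: "y \<le> Y"
    have "N \<le> 2 * n * s * q * 2"
    proof -
      have "A * (1 - 4 * \<rho> * A) \<le> A * 1" using A \<rho> by (intro mult_left_mono) auto
      then have "A * (1 - 4 * \<rho> * A) \<le> 2" using A2 by simp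
      then have "2 * (n * s * q) * (A * (1 - 4 * \<rho> * A)) \<le> 2 * (n * s * q) * 2"
        using sqp by (intro mult_left_mono) auto
      then show ?thesis unfolding N_def by (simp add: mult.assoc)
    qed
    then have "y * N \<le> y * (4 * n * s * q)" using y by (intro mult_left_mono) auto
    also have "\<dots> \<le> Y * (4 * n * s * q)" using yY n s q by (intro mult_right_mono) auto
    finally have "y * N \<le> 4 * n * s * q * Y" by (simp only: mult.commute)
    then show ?thesis using A4[OF A2] K by linarith
  next
    assume \<rho>2: "\<rho> \<ge> 1 / 2"
    have "0 \<le> 2 * n * s * q * A\<^sup>2" using n s q by (intro mult_nonneg_nonneg) auto
    then have "N \<le> 0" using NA[OF \<rho>2] by linarith
    then have "y * N \<le> 0" using y by (intro mult_nonneg_nonpos)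
    moreover assume "A \<le> 2"
    ultimately show ?thesis using A4 K pY by linarith
  next
    assume \<rho>2: "\<rho> \<ge> 1 / 2"
    assume "y \<ge> L / (2 * n * s * q)"
    then have yl: "L \<le> y * (2 * n * s * q)" using sqp by (simp add: pos_divide_le_eq mult.assoc)
    have "y * N \<le> - (y * (2 * n * s * q)) * A\<^sup>2" using mult_left_mono[OF NA[OF \<rho>2] y] by (simp add: mult_ac)
    also have "\<dots> \<le> - L * A\<^sup>2" using yl by (intro mult_right_mono) auto
    finally have "y * N \<le> - (L * A\<^sup>2)" by simp
    then show ?thesis using K Lp pY by linarith
  qed
  then show ?thesis using tot by simp
qed

lemma one_minus_power_inverse_ge:
  fixes \<theta> :: real
  assumes "0 < \<theta>" "\<theta> \<le> 1" "0 < q"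
  shows "1 / (real q * \<theta>) \<le> 1 / (1 - (1 - \<theta>) ^ q)"
proof -
  have "1 - real q * \<theta> \<le> (1 - \<theta>) ^ q"
    using Bernoulli_inequality[of "- \<theta>" q] assms by simp
  moreover have "(1 - \<theta>) ^ q < 1" using assms by (simp add: power_less_one_iff)
  ultimately show ?thesis using assms by (intro divide_left_mono) auto
qed

lemma pressure_deviation_bounded_below:
  fixes g :: "'a::euclidean_space \<Rightarrow> real \<Rightarrow> real"
  assumes dev: "pressure_deviation D k \<sigma> T g" and t: "ereal t < T"
  obtains M where "\<And>x s. bpress D x \<le> R \<Longrightarrow> 0 \<le> s \<Longrightarrow> s \<le> t \<Longrightarrow> - M < g x s"
proof -
  define S where "S = cball (0::'a) (sqrt \<bar>R - D\<bar>) \<times> {0..t}"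
  have "S \<subseteq> UNIV \<times> {t. 0 \<le> t \<and> ereal t < T}"
    using t by (auto simp: S_def intro: le_less_trans[of "ereal _" "ereal t"])
  then have "continuous_on S (\<lambda>(x, t). g x t)"
    using dev unfolding pressure_deviation_def by (meson continuous_on_subset)
  then have "bounded ((\<lambda>(x, t). g x t) ` S)"
    by (intro compact_imp_bounded compact_continuous_image) (auto simp: S_def intro: compact_Times)
  then obtain M where M: "\<And>y. y \<in> S \<Longrightarrow> \<bar>case y of (x, t) \<Rightarrow> g x t\<bar> \<le> M"
    unfolding bounded_iff real_norm_def by blast
  show thesis
  proof (rule that[of "M + 1"])
    fix x :: 'a and s assume "bpress D x \<le> R" "0 \<le> s" "s \<le> t"
    then have "(norm x)\<^sup>2 \<le> \<bar>R - D\<bar>" by (simp add: bpress_def)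
    then have "norm x \<le> sqrt \<bar>R - D\<bar>" by (simp add: real_le_rsqrt)
    then have "(x, s) \<in> S" using \<open>0 \<le> s\<close> \<open>s \<le> t\<close> by (simp add: S_def)
    from M[OF this] show "- (M + 1) < g x s" by simp
  qed
qed

text \<open>
  Comparison with \<open>-\<delta> e\<^bsup>Kt\<^esup> \<Phi>(Z)\<close> on the ball \<open>Z < R\<close>, where \<open>\<Phi>\<close> becomes infinite at \<open>Z = R\<close>: near the boundary the barrier lies
  below every bound for the continuous function \<open>g\<close>.  The constant \<open>K\<close> depends on neither \<open>\<delta>\<close> nor
  \<open>R\<close>, so that \<open>R\<close> may be chosen after \<open>\<delta>\<close>; for \<open>Z \<le> R/2\<close> the profile is at most \<open>(2 Z\<^sup>q)\<^sup>s\<close>, whatever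
  \<open>R\<close>.
\<close>

lemma pressure_deviation_nonneg_above:
  fixes g :: "'a::euclidean_space \<Rightarrow> real \<Rightarrow> real"
  assumes D: "D > 0" and k: "k > 1" and dev: "pressure_deviation D k (- 1) T g"
    and init: "\<And>x. g x 0 \<ge> 0" and t: "0 \<le> t" "ereal t < T"
  shows "g x t \<ge> 0"
proof (rule ccontr)
  assume neg: "\<not> g x t \<ge> 0"
  define n where "n = real DIM('a)"
  have n1: "n \<ge> 1" unfolding n_def using DIM_positive[where 'a='a] by linarith
  define s :: nat where "s = nat \<lceil>2 / (k - 1)\<rceil> + 1"
  define q :: nat where "q = 2 * DIM('a)"
  have s1: "s \<ge> 1" and q2: "q \<ge> 2" using DIM_positive[where 'a='a] by (simp_all add: s_def q_def)
  have qn: "real q = 2 * n" by (simp add: q_def n_def)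
  have "2 / (k - 1) \<le> real s" unfolding s_def by linarith
  then have ks: "(k - 1) * real s \<ge> 2" using k by (simp add: pos_divide_le_eq mult.commute)
  define L where "L = 2 * n * real s * real q + 4 * real s * (real s + 1) * (real q)\<^sup>2"
  \<comment> \<open>A bound for \<open>\<eta> \<Phi> / Z\<close> on \<open>Z \<le> 2D\<close>, where \<open>A \<le> 2\<close> and \<open>\<eta> \<le> 1\<close>.\<close>
  define Y where "Y = ((2 * D) ^ q * 2) ^ s / D"
  define K where "K = 4 * L + 4 * n * real s * real q * Y + 1"
  have Y: "Y \<ge> 0" using D by (simp add: Y_def)
  have nsq: "2 * n * real s * real q > 0" using n1 s1 q2 by simp
  have L: "L \<ge> 0" unfolding L_def using n1 by (intro add_nonneg_nonneg) auto
  have K: "K > 0" unfolding K_def using L Y nsq n1 by (intro add_nonneg_pos add_nonneg_nonneg) auto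
  define Z where "Z = bpress D x"
  have Z: "Z > 0" using D bpress_ge[of D x] by (simp add: Z_def)
  \<comment> \<open>Keeps \<open>\<eta> = d e\<^bsup>K\<tau>\<^esup>\<close> at most \<open>1\<close> and makes the barrier at \<open>x\<close> contradict \<open>neg\<close>.\<close>
  define d where "d = min (exp (- K * t)) (- g x t / (exp (K * t) * (2 * Z ^ q) ^ s))"
  have d: "d > 0" using Z neg by (simp add: d_def divide_neg_pos)
  \<comment> \<open>The last summand makes \<open>\<eta> \<Phi> / Z\<close> exceed the threshold \<open>L / (2 n s q)\<close> where \<open>A > 2\<close>.\<close>
  define R where "R = 4 * D + 2 * Z + 2 + 2 * (L / (2 * n * real s * real q)) / d"
  have Ld: "2 * (L / (2 * n * real s * real q)) / d \<ge> 0"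
    by (intro divide_nonneg_nonneg mult_nonneg_nonneg) (use L n1 d in auto)
  have R: "R \<ge> 4 * D" "R \<ge> 2 * Z" "R \<ge> 2" "R > 0"
    using Ld D Z unfolding R_def by linarith+
  have "2 * (L / (2 * n * real s * real q)) / d \<le> R" using D Z unfolding R_def by linarith
  then have "2 * (L / (2 * n * real s * real q)) \<le> R * d"
    using d by (simp only: pos_divide_le_eq)
  then have RL: "L / (2 * n * real s * real q) \<le> d * (R / 2)" by (simp add: mult.commute)
  define A where "A = (\<lambda>r. 1 / (1 - (r / R) ^ q))"
  define F where "F = (\<lambda>r. (r ^ q * A r) ^ s)"
  have A1: "A r \<ge> 1" if "0 < r" "r < R" for r
  proof -
    have "(r / R) ^ q < 1" using that R q2 by (simp add: power_less_one_iff)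
    moreover have "(r / R) ^ q \<ge> 0" using that R by simp
    ultimately show ?thesis by (simp add: A_def)
  qed
  have half: "(r / R) ^ q \<le> 1 / 2" if "0 < r" "r \<le> R / 2" for r
  proof -
    have "(r / R) ^ q \<le> (r / R) ^ 1" using that R q2 by (intro power_decreasing) auto
    also have "\<dots> \<le> 1 / 2" using that R by (simp add: pos_divide_le_eq)
    finally show ?thesis .
  qed
  have A2: "A r \<le> 2" if "0 < r" "r \<le> R / 2" for r
    using half[OF that] by (simp add: A_def field_simps)
  have Fp: "F r > 0" if "0 < r" "r < R" for r
    using A1[OF that] that by (simp add: F_def)
  have Flow: "F r \<ge> A r" "F r \<ge> r * r" if "1 \<le> r" "r < R" for r
  proof -
    have a: "A r \<ge> 1" using A1 that by simp
    have rq: "r ^ q \<ge> r ^ 2" using that q2 by (intro power_increasing) auto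
    have r2: "r ^ 2 \<ge> 1" using that by simp
    have "r ^ q * A r \<ge> 1 * A r" using rq r2 a by (intro mult_right_mono) auto
    moreover have "r ^ q * A r \<ge> r ^ 2 * 1" using rq r2 a by (intro mult_mono) auto
    moreover have "F r \<ge> (r ^ q * A r) ^ 1"
      unfolding F_def using calculation r2 s1 by (intro power_increasing) linarith+
    ultimately show "F r \<ge> A r" "F r \<ge> r * r" by (auto simp: power2_eq_square)
  qed
  obtain M where M: "\<And>y s. bpress D y \<le> R \<Longrightarrow> 0 \<le> s \<Longrightarrow> s \<le> t \<Longrightarrow> - M < g y s"
    using pressure_deviation_bounded_below[OF dev t(2)] by blast
  \<comment> \<open>Bernoulli: on \<open>Z = B\<close> the factor \<open>A\<close> is at least \<open>1 / (q \<theta>)\<close>, so the barrier passes below \<open>-M\<close>.\<close>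
  define \<theta> where "\<theta> = min (1 / 2) (d / (real q * (\<bar>M\<bar> + 1)))"
  have \<theta>: "0 < \<theta>" "\<theta> \<le> 1 / 2" unfolding \<theta>_def using d q2 by (simp, intro min.cobounded1)
  define B where "B = R * (1 - \<theta>)"
  have B: "B < R" "R / 2 \<le> B" using R \<theta> by (simp_all add: B_def)
  have AB: "d * A B \<ge> \<bar>M\<bar> + 1"
  proof -
    have "\<theta> \<le> d / (real q * (\<bar>M\<bar> + 1))" by (simp add: \<theta>_def)
    then have "(\<bar>M\<bar> + 1) * (real q * \<theta>) \<le> d" using q2 by (simp add: pos_le_divide_eq mult_ac)
    then have "\<bar>M\<bar> + 1 \<le> d * (1 / (real q * \<theta>))" using q2 \<theta> by (simp add: pos_le_divide_eq)
    also have "\<dots> \<le> d * A B"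
    proof (rule mult_left_mono)
      have "A B = 1 / (1 - (1 - \<theta>) ^ q)" using R by (simp add: A_def B_def)
      then show "1 / (real q * \<theta>) \<le> A B" using one_minus_power_inverse_ge[of \<theta> q] \<theta> q2 by simp
    qed (use d in simp)
    finally show ?thesis .
  qed
  have "- d * exp (K * t) * F (bpress D x) < g x t"
  proof (rule radial_barrier[OF dev t(2), where A = 0 and B = B and J = "{0<..<R}" and F = F
        and ?F1.0 = "\<lambda>r. real s * real q * A r * F r / r"
        and ?F2.0 = "\<lambda>r. real s * real q * A r * (real q * (real s + 1) * A r - real q - 1) * F r / r\<^sup>2"])
    show "bpress D y \<in> {0<..<R}" if "bpress D y \<le> B" for y :: 'a
      using bpress_ge[of D y] D B that by auto
    show "(F has_real_derivative real s * real q * A r * F r / r) (at r)" if "r \<in> {0<..<R}" for r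
      unfolding F_def A_def by (rule blowup_profile_deriv) (use that s1 q2 in auto)
    show "((\<lambda>r. real s * real q * A r * F r / r) has_real_derivative
           real s * real q * A r * (real q * (real s + 1) * A r - real q - 1) * F r / r\<^sup>2) (at r)"
      if "r \<in> {0<..<R}" for r
      unfolding F_def A_def by (rule blowup_profile_deriv) (use that s1 q2 in auto)
    show "- d * F (bpress D y) < g y 0" if "bpress D y \<le> B" for y
    proof -
      have "d * F (bpress D y) > 0" using Fp[of "bpress D y"] bpress_ge[of D y] D B that d by simp
      then show ?thesis using init[of y] by simp
    qed
    show "- d * exp (K * \<tau>) * F (bpress D y) < g y \<tau>"
      if y: "bpress D y = 0 \<or> bpress D y = B" and \<tau>: "0 \<le> \<tau>" "\<tau> \<le> t" for y \<tau>
    proof -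
      have y: "bpress D y = B" using y D bpress_ge[of D y] by auto
      have g: "- M < g y \<tau>" using M y B \<tau> by simp
      have "exp (K * \<tau>) \<ge> 1" using K \<tau> by simp
      moreover have "F B \<ge> A B" using Flow B R by simp
      moreover have "A B \<ge> 1" using A1 B R by simp
      ultimately have "d * A B \<le> d * (exp (K * \<tau>) * F B)"
        using d mult_mono[of 1 "exp (K * \<tau>)" "A B" "F B"] by simp
      then show ?thesis using AB g unfolding y by (simp add: mult.assoc)
    qed
    fix y :: 'a and \<tau> r c
    assume r: "r = bpress D y" and c: "c = - d * exp (K * \<tau>)" and rB: "r < B" and \<tau>: "0 < \<tau>" "\<tau> \<le> t"
    define e where "e = - c"
    have ed: "d \<le> e" using d K \<tau> by (simp add: e_def c)
    have e1: "e \<le> 1"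
    proof -
      have "d * exp (K * \<tau>) \<le> exp (- K * t) * exp (K * t)"
        using d K \<tau> by (intro mult_mono) (auto simp: d_def)
      then show ?thesis by (simp add: e_def c exp_minus)
    qed
    have e: "e > 0" using ed d by simp
    have rD: "D \<le> r" "0 < r" "r < R" using D bpress_ge[of D y] r rB B by simp_all
    define w where "w = e * F r / r"
    have w: "w > 0" using e Fp rD by (simp add: w_def)
    define \<rho> where "\<rho> = (r - D) / r"
    have \<rho>: "0 \<le> \<rho>" "\<rho> \<le> 1" using rD D by (simp_all add: \<rho>_def)
    define E1 where "E1 = real s * real q * A r"
    define E2 where "E2 = real s * real q * A r * (real q * (real s + 1) * A r - real q - 1)"
    have cs: "(A r \<le> 2 \<and> w \<le> Y) \<or> (\<rho> \<ge> 1 / 2 \<and> (A r \<le> 2 \<or> w \<ge> L / (2 * n * real s * real q)))"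
    proof (cases "r \<le> 2 * D")
      case True
      then have a: "A r \<le> 2" using A2 rD R by simp
      have "r ^ q * A r \<le> (2 * D) ^ q * 2"
        using a A1[of r] rD True by (intro mult_mono power_mono) auto
      then have "F r \<le> ((2 * D) ^ q * 2) ^ s"
        unfolding F_def using A1[of r] rD by (intro power_mono) auto
      then have "e * F r \<le> 1 * ((2 * D) ^ q * 2) ^ s"
        using e e1 Fp[of r] rD by (intro mult_mono) auto
      then have "w \<le> Y" unfolding w_def Y_def using rD D by (intro frac_le) auto
      then show ?thesis using a by simp
    next
      case False
      then have \<rho>2: "\<rho> \<ge> 1 / 2" using rD by (simp add: \<rho>_def field_simps)
      show ?thesis
      proof (cases "r \<le> R / 2")
        case True
        then show ?thesis using A2 rD \<rho>2 by simp
      next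
        case F: False
        have r1: "1 \<le> r" using F R by simp
        have "d * (R / 2) \<le> e * r" using ed F d R by (intro mult_mono) auto
        also have "\<dots> = e * (r * r) / r" using rD by simp
        also have "\<dots> \<le> w" unfolding w_def using Flow[OF r1 rD(3)] e rD by (intro divide_right_mono mult_left_mono) auto
        finally have "L / (2 * n * real s * real q) \<le> w" using RL by linarith
        then show ?thesis using \<rho>2 by blast
      qed
    qed
    have ineq: "(1 + w) * (2 * n * E1 + 4 * \<rho> * E2) - 4 * k * \<rho> * E1 - 4 * k * \<rho> * w * E1\<^sup>2 < K"
      by (rule blowup_profile_inequality[OF A1 less_imp_le[OF w] \<rho> ks _ _ n1 qn L_def _ Y cs E1_def E2_def])
         (use rD k s1 in \<open>auto simp: K_def\<close>)
    have cF: "c * F r = - w * r" using rD by (simp add: w_def e_def)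
    have rr: "r - D = \<rho> * r" using rD by (simp add: \<rho>_def)
    have c1: "c * (E1 * F r / r) = - w * E1" "c * (E2 * F r / r\<^sup>2) * r = - w * E2"
      using rD by (simp_all add: w_def e_def power2_eq_square)
    have "K * c * F r = - (w * r) * K" using cF by (simp add: mult.assoc)
    also have "\<dots> < - (w * r) * ((1 + w) * (2 * n * E1 + 4 * \<rho> * E2) - 4 * k * \<rho> * E1 - 4 * k * \<rho> * w * E1\<^sup>2)"
      using ineq w rD by simp
    also have "\<dots> = (r + w * r) * (2 * n * (- w * E1) + 4 * \<rho> * (- w * E2))
       - 4 * k * (\<rho> * r) * (- w * E1) + 4 * k * (\<rho> * r) * (- w * E1)\<^sup>2"
      by (simp add: power2_eq_square algebra_simps)
    also have "\<dots> = (r + - 1 * c * F r) *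
          (c * (2 * n * (E1 * F r / r) + 4 * (r - D) * (E2 * F r / r\<^sup>2))) -
          4 * k * (r - D) * (c * (E1 * F r / r)) - 4 * - 1 * k * (r - D) * (c * (E1 * F r / r))\<^sup>2"
    proof -
      have "c * (2 * n * (E1 * F r / r) + 4 * (r - D) * (E2 * F r / r\<^sup>2))
          = 2 * n * (c * (E1 * F r / r)) + 4 * \<rho> * (c * (E2 * F r / r\<^sup>2) * r)"
        unfolding rr by (simp add: algebra_simps)
      moreover have "r + - 1 * c * F r = r + w * r" using cF by simp
      ultimately show ?thesis unfolding c1 rr by simp
    qed
    finally show "K * c * F r < (r + - 1 * c * F r) *
          (c * (2 * real DIM('a) * (real s * real q * A r * F r / r) + 4 * (r - D) *
             (real s * real q * A r * (real q * (real s + 1) * A r - real q - 1) * F r / r\<^sup>2))) -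
          4 * k * (r - D) * (c * (real s * real q * A r * F r / r)) -
          4 * - 1 * k * (r - D) * (c * (real s * real q * A r * F r / r))\<^sup>2"
      unfolding E1_def E2_def n_def .
  qed (use Z R B t in \<open>auto simp: Z_def\<close>)
  moreover have "d * (exp (K * t) * F Z) \<le> - g x t"
  proof -
    have "Z ^ q * A Z \<le> 2 * Z ^ q" using A2[of Z] Z R by simp
    then have "F Z \<le> (2 * Z ^ q) ^ s"
      unfolding F_def using A1[of Z] Z R by (intro power_mono) auto
    then have "d * (exp (K * t) * F Z) \<le> d * (exp (K * t) * (2 * Z ^ q) ^ s)" using d by simp
    moreover have "d * (exp (K * t) * (2 * Z ^ q) ^ s) \<le> - g x t"
    proof -
      have "d \<le> - g x t / (exp (K * t) * (2 * Z ^ q) ^ s)" unfolding d_def by (rule min.cobounded2)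
      moreover have "0 < exp (K * t) * (2 * Z ^ q) ^ s" using Z by simp
      ultimately show ?thesis by (simp only: pos_le_divide_eq)
    qed
    ultimately show ?thesis by linarith
  qed
  ultimately show False by (simp add: Z_def mult_ac)
qed

section \<open>The oscillating barrier\<close>

text \<open>
  The oscillating barrier.  The identity \<open>spectral\<close> is the strict subsolution property at infinity; it holds with
  margin \<open>\<epsilon>/2\<close> because \<open>4f''\<close> cancels the cosine in \<open>\<epsilon>f\<close> and leaves the constant.  The terms
  with factor \<open>\<zeta> = D/Z\<close> cost at most \<open>\<epsilon>/4\<close> on \<open>Z \<ge> A\<close>, and the quadratic terms less than \<open>\<epsilon>/4\<close> for
  amplitudes up to \<open>c0\<close>.  The point and the constant depend on \<open>g0\<close>, but not on the existence time or on \<open>g\<close>.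
\<close>

lemma pressure_deviation_decay_bound:
  fixes g0 :: "'a::euclidean_space \<Rightarrow> real"
  defines "n \<equiv> real DIM('a)"
  assumes D: "D > 0" and k: "k \<ge> 0" and \<epsilon>: "\<epsilon> > 0" and b: "b = (n - 2 * k - 2) / 2" "b \<ge> 0"
    and \<sigma>: "\<sigma> = 1 \<or> \<sigma> = - 1"
    and g0: "continuous_on UNIV g0" "\<And>x. g0 x > 0"
  shows "\<exists>x c. c > 0 \<and> (\<forall>T g t. pressure_deviation D k \<sigma> T g \<and> (\<forall>x. g x 0 = g0 x) \<and>
            (\<forall>x t. 0 \<le> t \<and> ereal t < T \<longrightarrow> g x t \<ge> 0) \<and> 0 \<le> t \<and> ereal t < T
            \<longrightarrow> c * exp (- (b\<^sup>2 + \<epsilon>) * t) \<le> g x t)"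
proof -
  have n: "n > 0" unfolding n_def using DIM_positive[where 'a='a] by linarith
  define \<omega> where "\<omega> = sqrt \<epsilon> / 2"
  have \<omega>: "\<omega> > 0" "4 * \<omega>\<^sup>2 = \<epsilon>" using \<epsilon> by (simp_all add: \<omega>_def power_divide)
  define N1 where "N1 = \<omega> + b"
  define N2 where "N2 = \<omega>\<^sup>2 + b * \<omega> + b\<^sup>2"
  have N: "N1 \<ge> 0" "N2 \<ge> 0" using \<omega> b by (simp_all add: N1_def N2_def)
  define M1 where "M1 = 4 * N2 + 4 * N1 + 4 * k * N1"
  define M2 where "M2 = 2 * (2 * n * N1 + 4 * N2 + 4 * N1) + 4 * k * N1\<^sup>2"
  have M: "M1 \<ge> 0" "M2 \<ge> 0" using N k n by (simp_all add: M1_def M2_def)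
  \<comment> \<open>Far enough out for the lower order terms, and at least \<open>1\<close> so that \<open>Z\<^bsup>-b/2\<^esup> \<le> 1\<close>.\<close>
  define A where "A = 1 + D + 4 * D * M1 / \<epsilon>"
  have "4 * D * M1 / \<epsilon> \<ge> 0" using D M \<epsilon> by simp
  then have A: "A \<ge> 1" "A > D" "4 * D * M1 / \<epsilon> \<le> A" using D by (simp_all add: A_def)
  have AM: "D * M1 \<le> A * (\<epsilon> / 4)" using A(3) \<epsilon> by (simp add: pos_divide_le_eq mult_ac)
  \<comment> \<open>The annulus \<open>A \<le> Z \<le> B\<close> is one period of \<open>f\<close> in \<open>ln Z\<close>, with the crest at \<open>\<tau>1\<close>.\<close>
  define \<tau>1 where "\<tau>1 = ln A + pi / \<omega>"
  define B where "B = exp (\<tau>1 + pi / \<omega>)"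
  define h where "h = b / 2"
  define f where "f = (\<lambda>\<tau>. 1 / 2 + cos (\<omega> * (\<tau> - \<tau>1)))"
  \<comment> \<open>\<open>f1\<close> and \<open>f2\<close> are \<open>e\<^bsup>b\<tau>/2\<^esup>\<close> times the first two derivatives of \<open>e\<^bsup>-b\<tau>/2\<^esup> f\<close>.\<close>
  define f1 where "f1 = (\<lambda>\<tau>. - \<omega> * sin (\<omega> * (\<tau> - \<tau>1)) - h * f \<tau>)"
  define f2 where "f2 = (\<lambda>\<tau>. - \<omega>\<^sup>2 * cos (\<omega> * (\<tau> - \<tau>1)) + b * \<omega> * sin (\<omega> * (\<tau> - \<tau>1)) + b\<^sup>2 / 4 * f \<tau>)"
  have f': "(f has_real_derivative - \<omega> * sin (\<omega> * (\<tau> - \<tau>1))) (at \<tau>)" for \<tau>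
    unfolding f_def by (auto intro!: derivative_eq_intros)
  have f1': "(f1 has_real_derivative f2 \<tau> + h * f1 \<tau>) (at \<tau>)" for \<tau>
    unfolding f1_def
    by (auto intro!: derivative_eq_intros f' simp: f2_def f1_def h_def power2_eq_square algebra_simps)
  have fb: "\<bar>f \<tau>\<bar> \<le> 3 / 2" for \<tau>
    using cos_le_one[of "\<omega> * (\<tau> - \<tau>1)"] cos_ge_minus_one[of "\<omega> * (\<tau> - \<tau>1)"]
    unfolding f_def abs_le_iff by linarith
  have sb: "\<bar>\<omega> * sin x\<bar> \<le> \<omega>" "\<bar>\<omega>\<^sup>2 * cos x\<bar> \<le> \<omega>\<^sup>2" for x
    using \<omega> by (simp_all add: abs_mult mult_left_le)
  have f1b: "\<bar>f1 \<tau>\<bar> \<le> N1" for \<tau>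
  proof -
    have "\<bar>h * f \<tau>\<bar> \<le> h * 2" unfolding abs_mult using b fb[of \<tau>] by (intro mult_mono) (auto simp: h_def)
    then show ?thesis using sb(1)[of "\<omega> * (\<tau> - \<tau>1)"] unfolding f1_def N1_def by (simp add: abs_le_iff h_def)
  qed
  have f2b: "\<bar>f2 \<tau>\<bar> \<le> N2" for \<tau>
  proof -
    have "\<bar>b\<^sup>2 / 4 * f \<tau>\<bar> \<le> b\<^sup>2 / 4 * 4" unfolding abs_mult using b fb[of \<tau>] by (intro mult_mono) auto
    moreover have "\<bar>b * (\<omega> * sin (\<omega> * (\<tau> - \<tau>1)))\<bar> \<le> b * \<omega>"
      unfolding abs_mult[of b] using b sb(1) by (intro mult_mono) auto
    ultimately show ?thesis using sb(2)[of "\<omega> * (\<tau> - \<tau>1)"] unfolding f2_def N2_def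
      by (simp add: abs_le_iff mult.assoc)
  qed
  have spectral: "4 * f2 \<tau> + 4 * b * f1 \<tau> + (b\<^sup>2 + \<epsilon>) * f \<tau> = \<epsilon> / 2" for \<tau>
    unfolding f2_def f1_def h_def f_def \<omega>(2)[symmetric] by (simp add: power2_eq_square algebra_simps)
  define P where "P = (\<lambda>r::real. r powr (- b / 2))"
  define F where "F = (\<lambda>r. P r * f (ln r))"
  define F1 where "F1 = (\<lambda>r. P r * f1 (ln r) / r)"
  define F2 where "F2 = (\<lambda>r. P r * (f2 (ln r) - f1 (ln r)) / r\<^sup>2)"
  have P': "(P has_real_derivative - h * P r / r) (at r)" if "r > 0" for r
    unfolding P_def
    by (rule DERIV_cong[OF has_real_derivative_powr[OF that]]) (use that in \<open>simp add: powr_diff h_def\<close>)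
  have F1: "(F has_real_derivative F1 r) (at r)" if "r > 0" for r
    unfolding F_def F1_def
    by (rule DERIV_cong[OF DERIV_mult[OF P'[OF that] DERIV_chain2[OF f' DERIV_ln[OF that]]]])
       (simp add: f1_def divide_inverse algebra_simps)
  have F2: "(F1 has_real_derivative F2 r) (at r)" if "r > 0" for r
    unfolding F1_def F2_def
  proof (rule DERIV_cong[OF DERIV_divide[OF DERIV_mult[OF P'[OF that] DERIV_chain2[OF f1' DERIV_ln[OF that]]] DERIV_ident]])
    define i where "i = inverse r"
    have ri: "r * i = 1" using that by (simp add: i_def)
    show "((- h * P r / r * f1 (ln r) + (f2 (ln r) + h * f1 (ln r)) * inverse r * P r) * r
        - P r * f1 (ln r) * 1) / (r * r) = P r * (f2 (ln r) - f1 (ln r)) / r\<^sup>2"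
      unfolding divide_inverse power2_eq_square inverse_mult_distrib i_def[symmetric]
      using ri by algebra
  qed (use that in simp)
  have AB: "A < exp \<tau>1" "exp \<tau>1 < B"
  proof -
    have "exp (ln A) < exp \<tau>1" unfolding exp_less_cancel_iff \<tau>1_def using \<omega> by simp
    then show "A < exp \<tau>1" using A by simp
    show "exp \<tau>1 < B" unfolding B_def exp_less_cancel_iff using \<omega> by simp
  qed
  have fAB: "f (ln A) = - 1 / 2" "f (ln B) = - 1 / 2" "f \<tau>1 = 3 / 2"
    using \<omega> by (simp_all add: f_def \<tau>1_def B_def)
  obtain b0 :: 'a where b0: "b0 \<in> Basis" using nonempty_Basis by blast
  define x1 :: 'a where "x1 = sqrt (exp \<tau>1 - D) *\<^sub>R b0"
  have x1: "bpress D x1 = exp \<tau>1"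
    using b0 AB A by (simp add: bpress_def x1_def)
  define S where "S = {x::'a. A \<le> bpress D x \<and> bpress D x \<le> B}"
  have "S \<subseteq> cball 0 (sqrt B)"
  proof
    fix x assume "x \<in> S"
    then have "(norm x)\<^sup>2 \<le> B" using D by (simp add: S_def bpress_def)
    then show "x \<in> cball 0 (sqrt B)" by (simp add: real_le_rsqrt)
  qed
  then have "bounded S" using bounded_cball bounded_subset by blast
  moreover have "closed S" unfolding S_def
    by (intro closed_Collect_conj closed_Collect_le continuous_intros)
  ultimately have "compact S" by (simp add: compact_eq_bounded_closed)
  moreover have "x1 \<in> S" using x1 AB by (simp add: S_def)
  ultimately obtain x0 where x0: "x0 \<in> S" "\<And>x. x \<in> S \<Longrightarrow> g0 x0 \<le> g0 x"
    using continuous_attains_inf[of S g0] g0(1) by (metis continuous_on_subset empty_iff subset_UNIV)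
  define c0 where "c0 = min (g0 x0 / 2) (\<epsilon> / (8 * (M2 + 1)))"
  have c0: "c0 > 0" using g0(2) \<epsilon> M by (simp add: c0_def)
  have c0g: "c0 * (3 / 2) < g0 x0" using g0(2)[of x0] by (simp add: c0_def min_def)
  have c0M: "c0 * M2 < \<epsilon> / 4"
  proof -
    have "c0 \<le> \<epsilon> / (8 * (M2 + 1))" by (simp add: c0_def)
    then have "c0 * M2 * 8 + c0 * 8 \<le> \<epsilon>" using M by (simp add: pos_le_divide_eq algebra_simps)
    then show ?thesis using c0 \<epsilon> by simp
  qed
  have P1: "0 < P r" "P r \<le> 1" if "r \<ge> A" for r
  proof -
    show "0 < P r" using that A by (simp add: P_def)
    have "P r \<le> r powr 0" unfolding P_def using that A b by (intro powr_mono) auto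
    then show "P r \<le> 1" using that A by simp
  qed
  have main: "c0 * exp (- (b\<^sup>2 + \<epsilon>) * t) * F (bpress D x) < g x t"
    if dev: "pressure_deviation D k \<sigma> T g" and init: "\<And>x. g x 0 = g0 x"
      and nn: "\<And>x t. 0 \<le> t \<Longrightarrow> ereal t < T \<Longrightarrow> g x t \<ge> 0" and t: "0 \<le> t" "ereal t < T"
      and x: "A \<le> bpress D x" "bpress D x \<le> B" for T g t x
  proof (rule radial_barrier[OF dev t(2), where A = A and B = B and J = "{0<..}" and F = F and ?F1.0 = F1 and ?F2.0 = F2])
    show "c0 * F (bpress D y) < g y 0" if y: "A \<le> bpress D y" "bpress D y \<le> B" for y
    proof -
      have "F (bpress D y) \<le> P (bpress D y) * (3 / 2)"
        unfolding F_def using P1[OF y(1)] fb[of "ln (bpress D y)"] by (intro mult_left_mono) auto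
      also have "\<dots> \<le> 1 * (3 / 2)" using P1[OF y(1)] by (intro mult_right_mono) auto
      finally have "F (bpress D y) \<le> 1 * (3 / 2)" .
      then have "c0 * F (bpress D y) \<le> c0 * (3 / 2)" using c0 by (intro mult_left_mono) auto
      also have "\<dots> < g0 y" using c0g x0(2)[of y] y by (simp add: S_def)
      finally show ?thesis by (simp add: init)
    qed
    show "c0 * exp (- (b\<^sup>2 + \<epsilon>) * s) * F (bpress D y) < g y s"
      if y: "bpress D y = A \<or> bpress D y = B" and s: "0 \<le> s" "s \<le> t" for y s
    proof -
      have "ereal s < T" using s t by (auto intro: le_less_trans[of "ereal s" "ereal t"])
      moreover have "F (bpress D y) < 0"
        using y P1[of "bpress D y"] AB fAB unfolding F_def by (auto simp: mult_pos_neg)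
      then have "c0 * exp (- (b\<^sup>2 + \<epsilon>) * s) * F (bpress D y) < 0" using c0 by (intro mult_pos_neg) auto
      ultimately show ?thesis using nn[OF s(1)] by (meson less_le_trans)
    qed
    fix y :: 'a and s r c
    assume r: "A < r" "r < B" and c: "c = c0 * exp (- (b\<^sup>2 + \<epsilon>) * s)" and s: "0 < s" "s \<le> t"
    have rp: "r > 0" "r \<ge> 1" "D < r" using r A by auto
    have cp: "c > 0" using c c0 by simp
    have "0 \<le> (b\<^sup>2 + \<epsilon>) * s" using s \<epsilon> by simp
    then have "exp (- (b\<^sup>2 + \<epsilon>) * s) \<le> 1" unfolding one_le_exp_iff exp_le_one_iff by linarith
    then have cc: "c \<le> c0" unfolding c using c0 by simp
    define \<zeta> where "\<zeta> = D / r"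
    have \<zeta>: "0 \<le> \<zeta>" "\<zeta> \<le> 1" "\<zeta> * r = D" using rp D by (simp_all add: \<zeta>_def)
    define u where "u = f (ln r)"
    define u1 where "u1 = f1 (ln r)"
    define u2 where "u2 = f2 (ln r)"
    define p where "p = P r"
    have p: "0 < p" "p \<le> 1" using P1[of r] r by (simp_all add: p_def)
    have ub: "\<bar>u\<bar> \<le> 3 / 2" "\<bar>u1\<bar> \<le> N1" "\<bar>u2\<bar> \<le> N2"
      unfolding u_def u1_def u2_def by (rule fb f1b f2b)+
    have sp: "4 * u2 + 4 * b * u1 + (b\<^sup>2 + \<epsilon>) * u = \<epsilon> / 2"
      unfolding u_def u1_def u2_def by (rule spectral)
    have lin: "2 * n * u1 + 4 * (1 - \<zeta>) * (u2 - u1) - 4 * k * (1 - \<zeta>) * u1 + (b\<^sup>2 + \<epsilon>) * u \<ge> \<epsilon> / 4"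
    proof -
      have "2 * n * u1 + 4 * (1 - \<zeta>) * (u2 - u1) - 4 * k * (1 - \<zeta>) * u1 + (b\<^sup>2 + \<epsilon>) * u
          = \<epsilon> / 2 - \<zeta> * (4 * u2 - 4 * u1 - 4 * k * u1)"
      proof -
        have "2 * n = 4 * b + 4 + 4 * k" using b(1) by (simp add: field_simps)
        then show ?thesis using sp by algebra
      qed
      moreover have "\<zeta> * (4 * u2 - 4 * u1 - 4 * k * u1) \<le> \<epsilon> / 4"
      proof -
        have "\<bar>k * u1\<bar> \<le> k * N1" unfolding abs_mult using k ub by (intro mult_mono) auto
        then have "4 * u2 - 4 * u1 - 4 * k * u1 \<le> M1" using ub unfolding M1_def by (simp add: abs_le_iff)
        then have "\<zeta> * (4 * u2 - 4 * u1 - 4 * k * u1) \<le> \<zeta> * M1" using \<zeta> by (intro mult_left_mono)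
        also have "\<dots> \<le> \<epsilon> / 4"
        proof -
          have "A * (\<epsilon> / 4) \<le> r * (\<epsilon> / 4)" using r \<epsilon> by (intro mult_right_mono) auto
          then have "D * M1 \<le> r * (\<epsilon> / 4)" using AM by linarith
          then show ?thesis using rp by (simp add: \<zeta>_def pos_divide_le_eq mult.commute)
        qed
        finally show ?thesis .
      qed
      ultimately show ?thesis by simp
    qed
    define Qn where "Qn = u * (2 * n * u1 + 4 * (1 - \<zeta>) * (u2 - u1)) - 4 * k * (1 - \<zeta>) * u1\<^sup>2"
    have Qn: "\<bar>Qn\<bar> \<le> M2"
    proof -
      have "\<bar>2 * n * u1\<bar> \<le> 2 * n * N1" unfolding abs_mult using n ub by (intro mult_mono) auto
      moreover have "\<bar>4 * (1 - \<zeta>) * (u2 - u1)\<bar> \<le> 4 * 1 * (N2 + N1)"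
        unfolding abs_mult using \<zeta> ub by (intro mult_mono) auto
      ultimately have "\<bar>2 * n * u1 + 4 * (1 - \<zeta>) * (u2 - u1)\<bar> \<le> 2 * n * N1 + 4 * 1 * (N2 + N1)"
        by (rule order.trans[OF abs_triangle_ineq add_mono])
      then have "\<bar>2 * n * u1 + 4 * (1 - \<zeta>) * (u2 - u1)\<bar> \<le> 2 * n * N1 + 4 * N2 + 4 * N1" by simp
      then have "\<bar>u * (2 * n * u1 + 4 * (1 - \<zeta>) * (u2 - u1))\<bar> \<le> 2 * (2 * n * N1 + 4 * N2 + 4 * N1)"
        unfolding abs_mult[of u] using ub n N by (intro mult_mono) auto
      moreover have "\<bar>4 * k * (1 - \<zeta>) * u1\<^sup>2\<bar> \<le> 4 * k * N1\<^sup>2"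
      proof -
        have "u1\<^sup>2 \<le> N1\<^sup>2" using ub N by (metis abs_le_square_iff abs_of_nonneg)
        then have "4 * k * (1 - \<zeta>) * u1\<^sup>2 \<le> 4 * k * 1 * N1\<^sup>2" using k \<zeta> by (intro mult_mono) auto
        then show ?thesis using k \<zeta> by simp
      qed
      ultimately show ?thesis
        unfolding Qn_def M2_def by (rule order.trans[OF abs_triangle_ineq4 add_mono])
    qed
    have small: "\<bar>\<sigma> * (c * (p / r)) * Qn\<bar> < \<epsilon> / 4"
    proof -
      have "p / r \<le> 1" using p rp by simp
      then have "c * (p / r) \<le> c0 * 1" using cc cp p rp by (intro mult_mono) auto
      moreover have "0 \<le> c * (p / r)" using cp p rp by simp
      ultimately have "\<bar>\<sigma> * (c * (p / r)) * Qn\<bar> \<le> c0 * M2"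
        using \<sigma> Qn c0 unfolding abs_mult by (intro mult_mono) auto
      then show ?thesis using c0M by linarith
    qed
    have "0 < c * p * ((2 * n * u1 + 4 * (1 - \<zeta>) * (u2 - u1) - 4 * k * (1 - \<zeta>) * u1 + (b\<^sup>2 + \<epsilon>) * u)
        + \<sigma> * (c * (p / r)) * Qn)"
    proof (rule mult_pos_pos)
      have "- (\<epsilon> / 4) < \<sigma> * (c * (p / r)) * Qn" using small by (simp only: abs_less_iff) argo
      from add_le_less_mono[OF lin this] show "0 < (2 * n * u1 + 4 * (1 - \<zeta>) * (u2 - u1) - 4 * k * (1 - \<zeta>) * u1 + (b\<^sup>2 + \<epsilon>) * u)
        + \<sigma> * (c * (p / r)) * Qn" by (simp only: add.right_inverse)
    qed (use cp p in simp)
    also have "\<dots> = (r + \<sigma> * c * F r) * (c * (2 * n * F1 r + 4 * (r - D) * F2 r))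
        - 4 * k * (r - D) * (c * F1 r) - 4 * \<sigma> * k * (r - D) * (c * F1 r)\<^sup>2 - - (b\<^sup>2 + \<epsilon>) * c * F r"
    proof -
      have rD: "r - D = (1 - \<zeta>) * r" using \<zeta>(3) by (simp add: algebra_simps)
      have F: "F r = p * u" "F1 r = p * u1 / r" "F2 r = p * (u2 - u1) / r\<^sup>2"
        by (simp_all add: F_def F1_def F2_def p_def u_def u1_def u2_def)
      show ?thesis unfolding F rD Qn_def using rp
        by (simp add: power2_eq_square field_simps)
    qed
    finally show "- (b\<^sup>2 + \<epsilon>) * c * F r < (r + \<sigma> * c * F r) * (c * (2 * real DIM('a) * F1 r + 4 * (r - D) * F2 r))
        - 4 * k * (r - D) * (c * F1 r) - 4 * \<sigma> * k * (r - D) * (c * F1 r)\<^sup>2"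
      unfolding n_def by simp
  qed (use A F1 F2 x t in auto)
  define c where "c = c0 * F (exp \<tau>1)"
  have "c > 0" using c0 P1[of "exp \<tau>1"] AB fAB by (simp add: c_def F_def)
  moreover have "c * exp (- (b\<^sup>2 + \<epsilon>) * t) \<le> g x1 t"
    if "pressure_deviation D k \<sigma> T g" "\<forall>x. g x 0 = g0 x"
      "\<forall>x t. 0 \<le> t \<and> ereal t < T \<longrightarrow> g x t \<ge> 0" "0 \<le> t" "ereal t < T" for T g t
    using main[of T g t x1] that x1 AB by (simp add: c_def mult_ac)
  ultimately show ?thesis by blast
qed

section \<open>The lower bound for the convergence rate\<close>

text \<open>
  A gap in \<open>z\<close> gives a gap in \<open>v = z\<^bsup>-k\<^esup>\<close>, since the slope of the power is smallest in modulus at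
  the larger argument.
\<close>

lemma powr_neg_gap:
  fixes a b k :: real
  assumes "0 < a" "a < b" "0 \<le> k"
  shows "k * b powr (- k - 1) * (b - a) \<le> a powr (- k) - b powr (- k)"
proof -
  have "\<exists>z. a < z \<and> z < b \<and> b powr (- k) - a powr (- k) = (b - a) * (- k * z powr (- k - 1))"
    by (rule MVT2) (use assms in \<open>auto intro!: derivative_eq_intros\<close>)
  then obtain z where z: "a < z" "z < b" "b powr (- k) - a powr (- k) = (b - a) * (- k * z powr (- k - 1))"
    by blast
  have "b powr (- k - 1) \<le> z powr (- k - 1)"
    using z assms by (intro powr_mono2') auto
  then have "(b - a) * (k * b powr (- k - 1)) \<le> (b - a) * (k * z powr (- k - 1))"
    using assms by (intro mult_left_mono) auto
  then show ?thesis using z(3) by (simp add: mult_ac)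
qed

theorem theorem1p2:
  fixes m D \<epsilon> :: real and v0 :: "'a::euclidean_space \<Rightarrow> real"
  assumes "DIM('a) > 2" and "m < m_star DIM('a)" and "D > 0"
    and "continuous_on UNIV v0"
    and "(\<forall>x. 0 < v0 x \<and> v0 x < barenblatt m D x) \<or> (\<forall>x. v0 x > barenblatt m D x)"
    and "\<epsilon> > 0"
  shows "\<exists>C>0. \<forall>T v. 0 < T \<and> cauchy_solution m T v0 v \<longrightarrow>
           (\<forall>t. 0 \<le> t \<and> ereal t < T \<longrightarrow>
              (SUP x. ereal \<bar>barenblatt m D x - v x t\<bar>)
                \<ge> ereal (C * exp (- (alpha_star DIM('a) m + \<epsilon>) * t)))"
proof -
  define n where "n = real DIM('a)"
  have n2: "n > 2" using assms(1) by (simp add: n_def)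
  have mn: "m * (n - 2) < n - 4"
    using assms(2) n2 by (simp add: m_star_def n_def[symmetric] pos_less_divide_eq)
  have m: "m < 1"
  proof (rule ccontr)
    assume "\<not> m < 1"
    then have "1 * (n - 2) \<le> m * (n - 2)" using n2 by (intro mult_right_mono) auto
    then show False using mn by simp
  qed
  define k where "k = 1 / (1 - m)"
  have k: "k > 0" using m by (simp add: k_def)
  have k0: "- 1 / (1 - m) = - k" by (simp add: k_def)
  define b where "b = (n - 2 * k - 2) / 2"
  have b: "b \<ge> 0"
  proof -
    have "2 \<le> (n - 2) * (1 - m)" using mn by (simp add: algebra_simps)
    then have "2 * k \<le> n - 2" using m by (simp add: k_def pos_divide_le_eq)
    then show ?thesis by (simp add: b_def)
  qed
  have \<alpha>: "alpha_star DIM('a) m = b\<^sup>2"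
    by (simp add: alpha_star_def b_def fde_mu_def k_def n_def power_divide diff_diff_add add.commute)
  have Zp: "bpress D x > 0" for x :: 'a using bpress_ge[of D x] assms(3) by linarith
  have v0p: "v0 x > 0" for x
    using assms(5) by (auto simp: barenblatt_eq_powr intro: order.strict_trans1[OF powr_ge_zero])
  have Bp: "barenblatt m D x > 0" for x :: 'a using Zp[of x] by (simp add: barenblatt_eq_powr)
  have BZ: "barenblatt m D x powr (m - 1) = bpress D x" for x :: 'a
  proof -
    have "- 1 / (1 - m) * (m - 1) = 1" using m by (simp add: field_simps)
    then show ?thesis using Zp[of x] by (simp add: barenblatt_eq_powr powr_powr del: minus_divide_left)
  qed
  \<comment> \<open>The sign that makes the deviation positive at \<open>t = 0\<close>.\<close>
  define \<sigma> :: real where "\<sigma> = (if \<forall>x. v0 x < barenblatt m D x then 1 else - 1)"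
  have \<sigma>: "\<sigma> = 1 \<or> \<sigma> = - 1" by (simp add: \<sigma>_def)
  define g0 where "g0 = (\<lambda>x. \<sigma> * (v0 x powr (m - 1) - bpress D x))"
  have cs: "(\<sigma> = 1 \<and> (\<forall>x. v0 x < barenblatt m D x)) \<or> (\<sigma> = - 1 \<and> (\<forall>x. barenblatt m D x < v0 x))"
    using assms(5) unfolding \<sigma>_def by auto
  have g0p: "g0 x > 0" for x
    using cs
  proof (elim disjE conjE)
    assume s: "\<sigma> = 1" "\<forall>x. v0 x < barenblatt m D x"
    have "barenblatt m D x powr (m - 1) < v0 x powr (m - 1)"
      using m v0p s(2) by (intro powr_less_mono2_neg) auto
    then show ?thesis using s(1) by (simp add: g0_def BZ)
  next
    assume s: "\<sigma> = - 1" "\<forall>x. barenblatt m D x < v0 x"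
    have "v0 x powr (m - 1) < barenblatt m D x powr (m - 1)"
      using m Bp s(2) by (intro powr_less_mono2_neg) auto
    then show ?thesis using s(1) by (simp add: g0_def BZ)
  qed
  have g0c: "continuous_on UNIV g0"
    unfolding g0_def
    by (intro continuous_intros assms(4)) (use v0p in \<open>auto simp: less_imp_neq[THEN not_sym]\<close>)
  obtain x c where c: "c > 0" and bound: "\<And>T g t. pressure_deviation D k \<sigma> T g \<Longrightarrow> (\<And>x. g x 0 = g0 x) \<Longrightarrow>
       (\<And>x t. 0 \<le> t \<Longrightarrow> ereal t < T \<Longrightarrow> g x t \<ge> 0) \<Longrightarrow> 0 \<le> t \<Longrightarrow> ereal t < T \<Longrightarrow>
       c * exp (- (b\<^sup>2 + \<epsilon>) * t) \<le> g x t"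
    using pressure_deviation_decay_bound[OF assms(3) less_imp_le[OF k] assms(6) b_def[unfolded n_def] b \<sigma> g0c g0p]
    by blast
  define Z where "Z = bpress D x"
  have Z: "Z > 0" by (simp add: Z_def Zp)
  define C where "C = k * (Z + c) powr (- k - 1) * c"
  have "C > 0" using k c Z by (simp add: C_def)
  moreover have "ereal (C * exp (- (alpha_star DIM('a) m + \<epsilon>) * t)) \<le> (SUP x. ereal \<bar>barenblatt m D x - v x t\<bar>)"
    if sol: "cauchy_solution m T v0 v" and t: "0 \<le> t" "ereal t < T" for T v t
  proof -
    have pcs: "positive_classical_solution m T v" and ini: "\<And>x. v x 0 = v0 x"
      using sol unfolding cauchy_solution_def by auto
    have vp: "v y s > 0" if "0 \<le> s" "ereal s < T" for y s
      using pcs that unfolding positive_classical_solution_def Let_def by blast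
    define g where "g = (\<lambda>x t. \<sigma> * (v x t powr (m - 1) - bpress D x))"
    have dev: "pressure_deviation D k \<sigma> T g"
      unfolding g_def k_def by (rule pressure_deviation_of_solution[OF m pcs \<sigma>])
    have gi: "g y 0 = g0 y" for y by (simp add: g_def g0_def ini)
    then have gi0: "g y 0 \<ge> 0" for y using g0p[of y] by simp
    have nonneg: "g y s \<ge> 0" if s: "0 \<le> s" "ereal s < T" for y s
      using cs
    proof (elim disjE conjE)
      assume "\<sigma> = 1"
      then show ?thesis
        using pressure_deviation_nonneg_below[where g = g, OF assms(3) less_imp_le[OF k] _ gi0 s] dev by simp
    next
      assume \<sigma>1: "\<sigma> = - 1" and above: "\<forall>x. barenblatt m D x < v0 x"
      show ?thesis
      proof (cases "m \<le> 0")
        case True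
        have "barenblatt m D y \<le> v y s"
          using sol True barenblatt_stationary[OF assms(3) m, of T] above s
          unfolding cauchy_solution_def by (metis less_imp_le)
        then have "v y s powr (m - 1) \<le> barenblatt m D y powr (m - 1)"
          using m Bp by (intro powr_mono2') auto
        then show ?thesis by (simp add: g_def \<sigma>1 BZ)
      next
        case False
        then have "k > 1" using m by (simp add: k_def)
        then show ?thesis
          using pressure_deviation_nonneg_above[where g = g, OF assms(3) _ _ gi0 s] dev \<sigma>1 by simp
      qed
    qed
    define G where "G = c * exp (- (b\<^sup>2 + \<epsilon>) * t)"
    have "0 \<le> (b\<^sup>2 + \<epsilon>) * t" using t assms(6) by simp
    then have "exp (- (b\<^sup>2 + \<epsilon>) * t) \<le> 1" unfolding exp_le_one_iff by linarith
    then have G: "0 < G" "G \<le> c" using c by (simp_all add: G_def)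
    have gG: "G \<le> g x t" unfolding G_def by (rule bound[OF dev gi nonneg t])
    define z where "z = v x t powr (m - 1)"
    have z: "z > 0" using vp[OF t, of x] by (simp add: z_def)
    have vz: "v x t = z powr (- k)"
    proof -
      have "(m - 1) * - k = 1" using m by (simp add: k_def field_simps)
      then show ?thesis using vp[OF t, of x] by (simp add: z_def powr_powr del: mult_minus_right)
    qed
    have VZ: "barenblatt m D x = Z powr (- k)" by (simp add: barenblatt_eq_powr Z_def k_def)
    have mono: "k * (Z + c) powr (- k - 1) * G \<le> k * w powr (- k - 1) * G" if "0 < w" "w \<le> Z + c" for w
      by (intro mult_right_mono mult_left_mono powr_mono2') (use that k G in auto)
    have "k * (Z + c) powr (- k - 1) * G \<le> \<bar>barenblatt m D x - v x t\<bar>"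
      using cs
    proof (elim disjE conjE)
      assume "\<sigma> = 1"
      then have "Z + G \<le> z" using gG by (simp add: g_def z_def Z_def)
      then have "z powr (- k) \<le> (Z + G) powr (- k)" using k Z G by (intro powr_mono2') auto
      moreover have "k * (Z + G) powr (- k - 1) * (Z + G - Z) \<le> Z powr (- k) - (Z + G) powr (- k)"
        by (rule powr_neg_gap) (use Z G k in auto)
      ultimately show ?thesis using mono[of "Z + G"] Z G unfolding vz VZ by simp
    next
      assume "\<sigma> = - 1"
      then have zZ: "G \<le> Z - z" using gG by (simp add: g_def z_def Z_def)
      have "k * Z powr (- k - 1) * G \<le> k * Z powr (- k - 1) * (Z - z)"
        using zZ k by (intro mult_left_mono) auto
      also have "\<dots> \<le> z powr (- k) - Z powr (- k)"
        by (rule powr_neg_gap) (use z zZ G k in auto)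
      finally show ?thesis using mono[of Z] Z c unfolding vz VZ by simp
    qed
    then have "C * exp (- (alpha_star DIM('a) m + \<epsilon>) * t) \<le> \<bar>barenblatt m D x - v x t\<bar>"
      by (simp add: C_def G_def \<alpha> mult.assoc)
    then show ?thesis by (intro SUP_upper2[of x]) auto
  qed
  ultimately show ?thesis by blast
qed

end
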